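(* Let $G$ be a Lie group, and let $\alpha:G\to G$ be a continuous endomorphism. If $\alpha$ is positively expansive, then $\alpha$ has shadowing. Consequently, $\alpha$ is topologically expanding if and only if it is positively expansive. Moreover, if $G$ admits a positively expansive endomorphism, then the identity component $G_0$ is nilpotent.
   Context: All topological spaces are Hausdorff. Lie groups are finite-dimensional real Lie groups (not assumed connected or compact). Endomorphisms are assumed continuous. Shadowing (with respect to the left uniformity): let $G$ be a topological group with identity $e$ and $\alpha:G\to G$ a continuous endomorphism. For a neighbourhood $V$ of $e$, a sequence $(x_k)_{k\ge 0}$ in $G$ is a $V$-pseudo-orbit for $\alpha$ if $\alpha(x_k)^{-1}x_{k+1}\in V$ for all $k\ge 0$. For a neighbourhood $U$ of $e$, the sequence is $U$-shadowed by $x\in G$ if $\alpha^k(x)^{-1}x_k\in U$ for all $k\ge 0$. The endomorphism $\alpha$ has shadowing if for every neighbourhood $U$ of $e$ there is a neighbourhood $V$ of $e$ such that every one-sided infinite $V$-pseudo-orbit for $\alpha$ is $U$-shadowed by some point of $G$. The endomorphism $\alpha$ is positively expansive if there is a neighbourhood $U$ of $e$ such that $\bigcap_{n\ge 0}\alpha^{-n}(U)=\{e\}$. It is topologically expanding if it is positively expansive and has shadowing. *)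

theory Defs
  imports "HOL-Analysis.Analysis" "HOL-Algebra.Algebra"
begin

section \<open>Smooth maps\<close>

text \<open>
  On an open subset of a finite-dimensional space this says that \<open>f\<close> is of class \<open>C\<^sup>n\<close>: all
  iterated directional derivatives of order at most \<open>n\<close> exist and are continuous. It is meant
  for open \<open>S\<close> only.
\<close>
primrec Cn_on ::
  "nat \<Rightarrow> ('e::real_normed_vector \<Rightarrow> 'f::real_normed_vector) \<Rightarrow> 'e set \<Rightarrow> bool"
where
  "Cn_on 0 f S \<longleftrightarrow> continuous_on S f"
| "Cn_on (Suc n) f S \<longleftrightarrow>
     (\<forall>x\<in>S. f differentiable (at x)) \<and>
     (\<forall>v. Cn_on n (\<lambda>x. frechet_derivative f (at x) v) S)"

definition smooth_on ::
  "'e::real_normed_vector set \<Rightarrow> ('e \<Rightarrow> 'f::real_normed_vector) \<Rightarrow> bool" where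
  "smooth_on S f \<longleftrightarrow> (\<forall>n. Cn_on n f S)"


section \<open>Lie groups\<close>

text \<open>
  A chart is a pair \<open>(U, \<phi>)\<close>. The model space \<open>'e\<close> carries the dimension; a real normed space is
  finite-dimensional iff it has the Heine-Borel property, so the sort
  \<open>{real_normed_vector, heine_borel}\<close> is no restriction on top of \<^term>\<open>finite B \<and> span B = UNIV\<close>
  below. The class \<open>euclidean_space\<close> is not used because it excludes dimension zero, that is,
  discrete groups; for these \<open>'e\<close> can be \<^typ>\<open>unit\<close>, as the instance at the end of this
  theory shows.
\<close>
type_synonym ('a, 'e) chart = "'a set \<times> ('a \<Rightarrow> 'e)"

definition smooth_atlas ::
  "'a topology \<Rightarrow> ('a, 'e::{real_normed_vector, heine_borel}) chart set \<Rightarrow> bool" where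
  "smooth_atlas T A \<longleftrightarrow>
     (\<exists>B::'e set. finite B \<and> span B = UNIV) \<and>
     (\<Union>(U, \<phi>)\<in>A. U) = topspace T \<and>
     (\<forall>(U, \<phi>)\<in>A. openin T U \<and> open (\<phi> ` U) \<and>
        homeomorphic_map (subtopology T U) (top_of_set (\<phi> ` U)) \<phi>) \<and>
     (\<forall>(U, \<phi>)\<in>A. \<forall>(V, \<psi>)\<in>A. smooth_on (\<phi> ` (U \<inter> V)) (\<lambda>p. \<psi> (inv_into U \<phi> p)))"

locale topological_group = group G for G (structure) +
  fixes T :: "'a topology"
  assumes topspace_eq: "topspace T = carrier G"
    and Hausdorff: "Hausdorff_space T"
    and continuous_mult: "continuous_map (prod_topology T T) T (\<lambda>(x, y). x \<otimes> y)"
    and continuous_inv: "continuous_map T T (\<lambda>x. inv x)"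

text \<open>
  Neither connectedness nor second countability is required, so arbitrary discrete groups are
  Lie groups of dimension zero. The atlas need not be maximal.
\<close>
locale lie_group = topological_group G T for G (structure) and T +
  fixes A :: "('a, 'e::{real_normed_vector, heine_borel}) chart set"
  assumes atlas: "smooth_atlas T A"
    and smooth_mult:
      "\<And>U \<phi> V \<psi> W \<theta>. \<lbrakk>(U, \<phi>) \<in> A; (V, \<psi>) \<in> A; (W, \<theta>) \<in> A\<rbrakk> \<Longrightarrow>
         smooth_on {(p, q). p \<in> \<phi> ` U \<and> q \<in> \<psi> ` V \<and> inv_into U \<phi> p \<otimes> inv_into V \<psi> q \<in> W}
           (\<lambda>(p, q). \<theta> (inv_into U \<phi> p \<otimes> inv_into V \<psi> q))"
    and smooth_inv:
      "\<And>U \<phi> V \<psi>. \<lbrakk>(U, \<phi>) \<in> A; (V, \<psi>) \<in> A\<rbrakk> \<Longrightarrow>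
         smooth_on {p. p \<in> \<phi> ` U \<and> inv (inv_into U \<phi> p) \<in> V}
           (\<lambda>p. \<psi> (inv (inv_into U \<phi> p)))"

definition identity_component :: "('a, 'm) monoid_scheme \<Rightarrow> 'a topology \<Rightarrow> 'a set" where
  "identity_component G T = connected_component_of_set T \<one>\<^bsub>G\<^esub>"


section \<open>Nilpotent groups\<close>

primrec lower_central :: "('a, 'm) monoid_scheme \<Rightarrow> nat \<Rightarrow> 'a set" where
  "lower_central K 0 = carrier K"
| "lower_central K (Suc n) =
     generate K {x \<otimes>\<^bsub>K\<^esub> y \<otimes>\<^bsub>K\<^esub> inv\<^bsub>K\<^esub> x \<otimes>\<^bsub>K\<^esub> inv\<^bsub>K\<^esub> y | x y. x \<in> lower_central K n \<and> y \<in> carrier K}"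

definition nilpotent_group :: "('a, 'm) monoid_scheme \<Rightarrow> bool" where
  "nilpotent_group K \<longleftrightarrow> group K \<and> (\<exists>n. lower_central K n = {\<one>\<^bsub>K\<^esub>})"


section \<open>Dynamics of endomorphisms\<close>

definition neighbourhood_of :: "'a topology \<Rightarrow> 'a \<Rightarrow> 'a set \<Rightarrow> bool" where
  "neighbourhood_of T x U \<longleftrightarrow> U \<subseteq> topspace T \<and> (\<exists>W. openin T W \<and> x \<in> W \<and> W \<subseteq> U)"

definition continuous_endomorphism ::
  "('a, 'm) monoid_scheme \<Rightarrow> 'a topology \<Rightarrow> ('a \<Rightarrow> 'a) \<Rightarrow> bool" where
  "continuous_endomorphism G T \<alpha> \<longleftrightarrow> \<alpha> \<in> hom G G \<and> continuous_map T T \<alpha>"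

definition pseudo_orbit ::
  "('a, 'm) monoid_scheme \<Rightarrow> ('a \<Rightarrow> 'a) \<Rightarrow> 'a set \<Rightarrow> (nat \<Rightarrow> 'a) \<Rightarrow> bool" where
  "pseudo_orbit G \<alpha> V x \<longleftrightarrow>
     (\<forall>k. x k \<in> carrier G) \<and> (\<forall>k. inv\<^bsub>G\<^esub> (\<alpha> (x k)) \<otimes>\<^bsub>G\<^esub> x (Suc k) \<in> V)"

definition shadowed_by ::
  "('a, 'm) monoid_scheme \<Rightarrow> ('a \<Rightarrow> 'a) \<Rightarrow> 'a set \<Rightarrow> (nat \<Rightarrow> 'a) \<Rightarrow> 'a \<Rightarrow> bool" where
  "shadowed_by G \<alpha> U x z \<longleftrightarrow> (\<forall>k. inv\<^bsub>G\<^esub> ((\<alpha> ^^ k) z) \<otimes>\<^bsub>G\<^esub> x k \<in> U)"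

definition has_shadowing ::
  "('a, 'm) monoid_scheme \<Rightarrow> 'a topology \<Rightarrow> ('a \<Rightarrow> 'a) \<Rightarrow> bool" where
  "has_shadowing G T \<alpha> \<longleftrightarrow>
     (\<forall>U. neighbourhood_of T \<one>\<^bsub>G\<^esub> U \<longrightarrow>
       (\<exists>V. neighbourhood_of T \<one>\<^bsub>G\<^esub> V \<and>
         (\<forall>x. pseudo_orbit G \<alpha> V x \<longrightarrow> (\<exists>z\<in>carrier G. shadowed_by G \<alpha> U x z))))"

definition positively_expansive ::
  "('a, 'm) monoid_scheme \<Rightarrow> 'a topology \<Rightarrow> ('a \<Rightarrow> 'a) \<Rightarrow> bool" where
  "positively_expansive G T \<alpha> \<longleftrightarrow>
     (\<exists>U. neighbourhood_of T \<one>\<^bsub>G\<^esub> U \<and>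
       (\<Inter>n. {x \<in> carrier G. (\<alpha> ^^ n) x \<in> U}) = {\<one>\<^bsub>G\<^esub>})"

definition topologically_expanding ::
  "('a, 'm) monoid_scheme \<Rightarrow> 'a topology \<Rightarrow> ('a \<Rightarrow> 'a) \<Rightarrow> bool" where
  "topologically_expanding G T \<alpha> \<longleftrightarrow> positively_expansive G T \<alpha> \<and> has_shadowing G T \<alpha>"


section \<open>A zero-dimensional model space\<close>

instantiation unit :: real_normed_vector
begin

definition zero_unit :: unit where "zero_unit = ()"
definition plus_unit :: "unit \<Rightarrow> unit \<Rightarrow> unit" where "plus_unit _ _ = ()"
definition scaleR_unit :: "real \<Rightarrow> unit \<Rightarrow> unit" where "scaleR_unit _ _ = ()"
definition norm_unit :: "unit \<Rightarrow> real" where "norm_unit _ = 0"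
definition dist_unit :: "unit \<Rightarrow> unit \<Rightarrow> real" where "dist_unit _ _ = 0"
definition sgn_unit :: "unit \<Rightarrow> unit" where "sgn_unit _ = ()"
definition uniformity_unit :: "(unit \<times> unit) filter" where
  "uniformity_unit = (INF e\<in>{0<..}. principal {(x, y). dist x y < e})"
definition open_unit :: "unit set \<Rightarrow> bool" where "open_unit _ \<longleftrightarrow> True"

instance
proof
  fix U :: "unit set"
  show "open U \<longleftrightarrow> (\<forall>x\<in>U. \<forall>\<^sub>F (x', y) in uniformity. x' = x \<longrightarrow> y \<in> U)"
    by (auto simp: open_unit_def case_prod_beta')
qed (auto simp: norm_unit_def dist_unit_def uniformity_unit_def)

end

instance unit :: heine_borel
proof
  fix f :: "nat \<Rightarrow> unit"
  have "((f o id) \<longlongrightarrow> ()) sequentially"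
    by (intro topological_tendstoI) (simp add: always_eventually)
  then show "\<exists>l r. strict_mono (r :: nat \<Rightarrow> nat) \<and> ((f o r) \<longlongrightarrow> l) sequentially"
    using strict_mono_id by blast
qed

end

theory Submission
  imports Defs "HOL-Homology.Homology"
begin

text \<open>
  Neither the exponential map nor the Lie algebra is used. Expansiveness makes \<open>\<alpha>\<close> injective near
  \<open>\<one>\<close>, hence open at \<open>\<one>\<close> by invariance of domain. By compactness there are neighbourhoods \<open>U n\<close>
  of \<open>\<one>\<close> shrinking to \<open>\<one>\<close> with \<open>\<alpha> ` U (Suc n) = U n\<close>. The error \<open>y\<^sub>k = (\<alpha>\<^sup>k z)\<inverse> x\<^sub>k\<close> of a pseudo-orbit
  satisfies \<open>y\<^sub>k\<^sub>+\<^sub>1 = \<alpha> (y\<^sub>k) v\<^sub>k\<close> with small \<open>v\<^sub>k\<close>, and solving this recursion backwards through the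
  contracting local inverse of a power of \<open>\<alpha>\<close> gives shadowing points for finite pieces; compactness
  gives one for the whole pseudo-orbit.

  For nilpotency, work in coordinates at \<open>\<one>\<close>. There the number of powers of \<open>x\<close> that stay in a small
  neighbourhood is comparable to \<open>1 / norm x\<close>. Counting powers shows that a local inverse of some
  \<open>g = \<alpha> ^^ M\<close> contracts by the factor 2 and that \<open>g\<close> is Lipschitz at \<open>\<one>\<close>. As \<open>norm (commut x y)\<close> is
  at most a constant times \<open>norm x * norm y\<close>, pulling a long iterated commutator back by \<open>g ^^ n\<close> makes
  it smaller than \<open>g ^^ n\<close> can undo, so it is trivial. A group generated by a set whose long iterated
  commutators vanish is nilpotent, and every neighbourhood of \<open>\<one>\<close> generates a group containing the
  identity component.
\<close>

section \<open>Finite-dimensional normed spaces\<close>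

text \<open>Induction on \<open>B\<close>. A new vector \<open>a\<close> has positive distance from
  \<open>span B\<close>: along a sequence in the span that tends to \<open>a\<close> the coordinates
  are Cauchy by the bound for \<open>B\<close>, so the limit would lie in the span.\<close>

lemma independent_coord_bound:
  fixes B :: "'e::real_normed_vector set"
  assumes "finite B" "independent B"
  shows "\<exists>K\<ge>0. \<forall>c. \<forall>b\<in>B. \<bar>c b\<bar> \<le> K * norm (\<Sum>b\<in>B. c b *\<^sub>R b)"
  using assms
proof (induction B rule: finite_induct)
  case empty
  then show ?case by (auto intro: exI[of _ 0])
next
  case (insert a B)
  have indep: "independent B" and a: "a \<notin> span B"
    using insert.prems insert.hyps by (auto simp: independent_insert)
  obtain K where K: "K \<ge> 0" "\<And>c b. b \<in> B \<Longrightarrow> \<bar>c b\<bar> \<le> K * norm (\<Sum>b\<in>B. c b *\<^sub>R b)"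
    using insert.IH[OF indep] by blast
  have "\<exists>d>0. \<forall>c. d \<le> norm (a - (\<Sum>b\<in>B. c b *\<^sub>R b))"
  proof (rule ccontr)
    assume "\<not> ?thesis"
    then have "\<forall>n. \<exists>c. norm (a - (\<Sum>b\<in>B. c b *\<^sub>R b)) < inverse (real (Suc n))"
      by (metis inverse_positive_iff_positive not_le of_nat_0_less_iff zero_less_Suc)
    then obtain c where c: "\<And>n. norm (a - (\<Sum>b\<in>B. c n b *\<^sub>R b)) < inverse (real (Suc n))"
      by metis
    define S where "S n = (\<Sum>b\<in>B. c n b *\<^sub>R b)" for n
    have "(\<lambda>n. S n - a) \<longlonglongrightarrow> 0"
      by (rule Lim_null_comparison[OF _ LIMSEQ_inverse_real_of_nat])
        (use c in \<open>auto simp: S_def norm_minus_commute intro!: always_eventually less_imp_le\<close>)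
    then have lim: "S \<longlonglongrightarrow> a" by (simp add: LIM_zero_iff)
    then have Cau: "Cauchy S" by (rule LIMSEQ_imp_Cauchy)
    have "\<exists>l. (\<lambda>n. c n b) \<longlonglongrightarrow> l" if b: "b \<in> B" for b
    proof -
      have le: "dist (c n b) (c m b) \<le> K * dist (S n) (S m)" for n m
        using K(2)[OF b, of "\<lambda>b. c n b - c m b"]
        by (simp add: dist_norm S_def scaleR_diff_left sum_subtractf)
      have "Cauchy (\<lambda>n. c n b)"
      proof (rule metric_CauchyI)
        fix e :: real assume "e > 0"
        then have "e / (K + 1) > 0" using K(1) by simp
        then obtain M where M: "\<And>m n. m \<ge> M \<Longrightarrow> n \<ge> M \<Longrightarrow> dist (S m) (S n) < e / (K + 1)"
          using Cau by (metis metric_CauchyD)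
        have "dist (c m b) (c n b) < e" if "m \<ge> M" "n \<ge> M" for m n
        proof -
          have "dist (c m b) (c n b) \<le> (K + 1) * dist (S m) (S n)"
            using le[of m n] by (simp add: algebra_simps add_increasing)
          also have "\<dots> < e" using M[OF that] K(1) by (simp add: field_simps)
          finally show ?thesis .
        qed
        then show "\<exists>M. \<forall>m\<ge>M. \<forall>n\<ge>M. dist (c m b) (c n b) < e" by blast
      qed
      then show ?thesis by (simp add: Cauchy_convergent_iff convergent_def)
    qed
    then obtain l where l: "\<And>b. b \<in> B \<Longrightarrow> (\<lambda>n. c n b) \<longlonglongrightarrow> l b" by metis
    have "S \<longlonglongrightarrow> (\<Sum>b\<in>B. l b *\<^sub>R b)"
      unfolding S_def by (intro tendsto_sum tendsto_scaleR l tendsto_const)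
    then have "a = (\<Sum>b\<in>B. l b *\<^sub>R b)" by (rule LIMSEQ_unique[OF lim])
    also have "\<dots> \<in> span B" by (intro span_sum span_scale span_base)
    finally show False using a by simp
  qed
  then obtain d where d: "d > 0" "\<And>c. d \<le> norm (a - (\<Sum>b\<in>B. c b *\<^sub>R b))" by blast
  define K' where "K' = K * (1 + norm a / d) + 1 / d"
  have K'0: "K' \<ge> 0" using K(1) d(1) by (simp add: K'_def)
  have "\<bar>c b\<bar> \<le> K' * norm (\<Sum>b\<in>insert a B. c b *\<^sub>R b)" if "b \<in> insert a B" for c b
  proof -
    define w where "w = (\<Sum>b\<in>B. c b *\<^sub>R b)"
    define t where "t = c a *\<^sub>R a + w"
    have t: "(\<Sum>b\<in>insert a B. c b *\<^sub>R b) = t"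
      using insert.hyps by (simp add: t_def w_def)
    have ca: "\<bar>c a\<bar> \<le> norm t / d"
    proof (cases "c a = 0")
      case False
      have "t = c a *\<^sub>R (a - (\<Sum>b\<in>B. (- c b / c a) *\<^sub>R b))"
        using False by (simp add: t_def w_def sum_negf scaleR_add_right scaleR_sum_right)
      then have "norm t = \<bar>c a\<bar> * norm (a - (\<Sum>b\<in>B. (- c b / c a) *\<^sub>R b))" by simp
      also have "\<dots> \<ge> \<bar>c a\<bar> * d" by (intro mult_left_mono d(2)) auto
      finally show ?thesis using d(1) by (simp add: field_simps)
    qed (use d in simp)
    have "\<bar>c b\<bar> \<le> K' * norm t"
    proof (cases "b = a")
      case True
      have "norm t / d \<le> K' * norm t"
        using K(1) d(1) by (simp add: K'_def algebra_simps)
      then show ?thesis using ca True by simp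
    next
      case False
      then have "\<bar>c b\<bar> \<le> K * norm w" using K(2) that by (simp add: w_def)
      also have "norm w \<le> norm t + \<bar>c a\<bar> * norm a"
        using norm_triangle_ineq4[of t "c a *\<^sub>R a"] by (simp add: t_def)
      also have "\<dots> \<le> norm t + norm t / d * norm a"
        using ca by (intro add_left_mono mult_right_mono) auto
      finally have "\<bar>c b\<bar> \<le> K * (norm t + norm t / d * norm a)" using K(1) by (simp add: mult_left_mono)
      also have "\<dots> \<le> K' * norm t" using d(1) by (simp add: K'_def algebra_simps)
      finally show ?thesis .
    qed
    then show ?thesis by (simp add: t)
  qed
  then show ?case using K'0 by blast
qed

lemma finite_span_basis:
  fixes B :: "'e::real_normed_vector set"
  assumes "finite B" "span B = UNIV"
  obtains C where "C \<subseteq> B" "finite C" "independent C" "span C = UNIV"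
proof -
  obtain C where "C \<subseteq> B" "independent C" "B \<subseteq> span C"
    using maximal_independent_subset by blast
  then show ?thesis using that[of C] assms
    by (metis finite_subset span_mono span_span top.extremum_uniqueI)
qed

lemma representation_bound:
  fixes B :: "'e::real_normed_vector set"
  assumes "finite B" "independent B" "span B = UNIV"
  shows "\<exists>K\<ge>0. \<forall>v. \<forall>b\<in>B. \<bar>representation B v b\<bar> \<le> K * norm v"
proof -
  obtain K where K: "K \<ge> 0" "\<And>c b. b \<in> B \<Longrightarrow> \<bar>c b\<bar> \<le> K * norm (\<Sum>b\<in>B. c b *\<^sub>R b)"
    using independent_coord_bound[OF assms(1,2)] by blast
  have "(\<Sum>b\<in>B. representation B v b *\<^sub>R b) = v" for v
    using assms by (intro real_vector.sum_representation_eq) auto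
  then have "\<bar>representation B v b\<bar> \<le> K * norm v" if "b \<in> B" for v b
    using K(2)[OF that, of "representation B v"] by simp
  then show ?thesis using K(1) by blast
qed

text \<open>The constant depends only on \<open>B\<close>, so it bounds a whole family of
  derivatives at once. This fits \<open>Cn_on\<close>, which controls derivatives one direction at a
  time: finitely many directions suffice.\<close>

lemma linear_bound_of_spanning:
  fixes B :: "'e::real_normed_vector set"
  assumes "finite B" "span B = UNIV"
  shows "\<exists>K\<ge>0. \<forall>f :: 'e \<Rightarrow> 'f::real_normed_vector. \<forall>C\<ge>0. linear f \<longrightarrow>
           (\<forall>b\<in>B. norm (f b) \<le> C) \<longrightarrow> (\<forall>v. norm (f v) \<le> C * K * norm v)"
proof -
  obtain B' where B': "B' \<subseteq> B" "finite B'" "independent B'" "span B' = UNIV"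
    using finite_span_basis[OF assms] .
  obtain K where K: "K \<ge> 0" "\<And>v b. b \<in> B' \<Longrightarrow> \<bar>representation B' v b\<bar> \<le> K * norm v"
    using representation_bound[OF B'(2-4)] by blast
  have "norm (f v) \<le> C * (card B' * K) * norm v"
    if f: "linear f" and C: "C \<ge> 0" "\<And>b. b \<in> B \<Longrightarrow> norm (f b) \<le> C" for f :: "'e \<Rightarrow> 'f" and C v
  proof -
    have "v = (\<Sum>b\<in>B'. representation B' v b *\<^sub>R b)"
      using B' by (intro real_vector.sum_representation_eq[symmetric]) auto
    then have "f v = (\<Sum>b\<in>B'. representation B' v b *\<^sub>R f b)"
      using linear_sum[OF f] linear_scale[OF f] by (metis (no_types, lifting) sum.cong)
    also have "norm \<dots> \<le> (\<Sum>b\<in>B'. K * norm v * C)"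
      using K C B'(1) by (intro sum_norm_le) (auto intro!: mult_mono)
    also have "\<dots> = C * (card B' * K) * norm v" by simp
    finally show ?thesis .
  qed
  moreover have "card B' * K \<ge> 0" using K by simp
  ultimately show ?thesis by blast
qed

lemma span_Times_UNIV:
  fixes B :: "'e::real_vector set" and C :: "'f::real_vector set"
  assumes "span B = UNIV" "span C = UNIV"
  shows "span ((\<lambda>b. (b, 0)) ` B \<union> (\<lambda>c. (0, c)) ` C) = UNIV" (is "span ?S = _")
proof -
  have l1: "linear (\<lambda>b::'e. (b, 0::'f))" and l2: "linear (\<lambda>c::'f. (0::'e, c))"
    by (auto intro!: linearI)
  have "(b, c) \<in> span ?S" for b c
  proof -
    have "(b, 0) \<in> span ((\<lambda>b. (b, 0::'f)) ` B)" "(0, c) \<in> span ((\<lambda>c. (0::'e, c)) ` C)"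
      unfolding linear_span_image[OF l1] linear_span_image[OF l2] assms by auto
    then have "(b, 0) \<in> span ?S" "(0, c) \<in> span ?S"
      by (meson Un_upper1 Un_upper2 span_mono subsetD)+
    from span_add[OF this] show ?thesis by simp
  qed
  then show ?thesis by auto
qed

section \<open>Invariance of domain in finite-dimensional normed spaces\<close>

lemma finite_dim_homeomorphic_Euclidean_space:
  fixes B :: "'e::real_normed_vector set"
  assumes "finite B" "span B = UNIV"
  obtains n where "(euclidean :: 'e topology) homeomorphic_space Euclidean_space n"
proof -
  obtain B' where B': "B' \<subseteq> B" "finite B'" "independent B'" "span B' = UNIV"
    using finite_span_basis[OF assms] .
  obtain K where K: "K \<ge> 0" "\<And>v b. b \<in> B' \<Longrightarrow> \<bar>representation B' v b\<bar> \<le> K * norm v"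
    using representation_bound[OF B'(2-4)] by blast
  define n where "n = card B'"
  obtain e where e: "bij_betw e {..<n} B'"
    using B'(2) ex_bij_betw_nat_finite by (metis atLeast0LessThan n_def)
  define \<Phi> where "\<Phi> v i = (if i < n then representation B' v (e i) else 0)" for v i
  define \<Psi> where "\<Psi> x = (\<Sum>i<n. x i *\<^sub>R e i)" for x
  have "continuous_on UNIV (\<lambda>v. representation B' v b)" if "b \<in> B'" for b
  proof (rule lipschitz_on_continuous_on[OF lipschitz_onI])
    fix v w :: 'e
    show "dist (representation B' v b) (representation B' w b) \<le> K * dist v w"
      using K(2)[OF that, of "v - w"] B' by (simp add: real_vector.representation_diff dist_norm)
  qed (rule K(1))
  moreover have "e i \<in> B'" if "i < n" for i using e that by (auto simp: bij_betw_def)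
  ultimately have "continuous_map euclidean euclideanreal (\<lambda>v. \<Phi> v i)" for i
    by (cases "i < n") (auto simp: \<Phi>_def)
  then have 1: "continuous_map euclidean (Euclidean_space n) \<Phi>"
    by (auto simp: Euclidean_space_def continuous_map_in_subtopology continuous_map_componentwise_UNIV \<Phi>_def)
  have 2: "continuous_map (Euclidean_space n) euclidean \<Psi>"
    unfolding \<Psi>_def Euclidean_space_def euclidean_product_topology continuous_map_iff_continuous
    by (intro continuous_intros continuous_on_subset[OF continuous_on_product_coordinates]) auto
  have 3: "\<Psi> (\<Phi> v) = v" for v
  proof -
    have "\<Psi> (\<Phi> v) = (\<Sum>i<n. representation B' v (e i) *\<^sub>R e i)"
      by (simp add: \<Psi>_def \<Phi>_def)
    also have "\<dots> = (\<Sum>b\<in>B'. representation B' v b *\<^sub>R b)"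
      using e by (rule sum.reindex_bij_betw)
    also have "\<dots> = v" using B' by (intro real_vector.sum_representation_eq) auto
    finally show ?thesis .
  qed
  have 4: "\<Phi> (\<Psi> x) = x" if x: "x \<in> topspace (Euclidean_space n)" for x
  proof -
    \<comment> \<open>The difference of two coordinate vectors with the same image under
      \<open>\<Psi>\<close>, hence zero by independence.\<close>
    define y where "y i = \<Phi> (\<Psi> x) i - x i" for i
    have "(\<Sum>i<n. y i *\<^sub>R e i) = \<Psi> (\<Phi> (\<Psi> x)) - \<Psi> x"
      by (simp add: y_def \<Psi>_def scaleR_diff_left sum_subtractf)
    then have "(\<Sum>i<n. y i *\<^sub>R e i) = 0" by (simp add: 3)
    moreover have "(\<Sum>i<n. y i *\<^sub>R e i) = (\<Sum>b\<in>B'. y (inv_into {..<n} e b) *\<^sub>R b)"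
      using e by (subst sum.reindex_bij_betw[OF e, symmetric])
        (auto simp: bij_betw_def inv_into_f_f intro!: sum.cong)
    ultimately have "y (inv_into {..<n} e b) = 0" if "b \<in> B'" for b
      using real_vector.independentD[OF B'(3,2) subset_refl _ that] by simp
    then have "y i = 0" if "i < n" for i
      using e that by (metis bij_betw_def image_eqI inv_into_f_f lessThan_iff)
    then have "\<Phi> (\<Psi> x) i = x i" for i
      using x by (cases "i < n") (auto simp: y_def \<Phi>_def topspace_Euclidean_space)
    then show ?thesis by blast
  qed
  have "homeomorphic_maps euclidean (Euclidean_space n) \<Phi> \<Psi>"
    using 1 2 3 4 by (simp add: homeomorphic_maps_def)
  then show ?thesis using that homeomorphic_space_def by blast
qed

lemma invariance_of_domain_finite_dim:
  fixes f :: "'e::real_normed_vector \<Rightarrow> 'e"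
  assumes "finite (B :: 'e set)" "span B = UNIV"
    and S: "open S" and f: "continuous_on S f" "inj_on f S"
  shows "open (f ` S)"
proof -
  obtain n where "(euclidean :: 'e topology) homeomorphic_space Euclidean_space n"
    using finite_dim_homeomorphic_Euclidean_space[OF assms(1,2)] .
  then obtain \<Phi> \<Psi> where h: "homeomorphic_maps (euclidean :: 'e topology) (Euclidean_space n) \<Phi> \<Psi>"
    unfolding homeomorphic_space_def by blast
  then have hm: "homeomorphic_map euclidean (Euclidean_space n) \<Phi>"
    and hc: "continuous_map euclidean (Euclidean_space n) \<Phi>" "continuous_map (Euclidean_space n) euclidean \<Psi>"
    and \<Psi>\<Phi>: "\<And>v. \<Psi> (\<Phi> v) = v"
    using homeomorphic_maps_map[THEN iffD1, OF h] h by (auto simp: homeomorphic_maps_def)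
  define g where "g = \<Phi> \<circ> f \<circ> \<Psi>"
  have op: "openin (Euclidean_space n) (\<Phi> ` S)"
    using homeomorphic_map_openness_eq[OF hm] S by auto
  have "continuous_map (subtopology (Euclidean_space n) (\<Phi> ` S)) (top_of_set S) \<Psi>"
    using hc(2) \<Psi>\<Phi> by (auto simp: continuous_map_in_subtopology continuous_map_from_subtopology)
  then have "continuous_map (subtopology (Euclidean_space n) (\<Phi> ` S)) (Euclidean_space n) g"
    unfolding g_def using f(1) hc(1) by (metis continuous_map_compose continuous_map_iff_continuous o_assoc)
  moreover have "inj_on g (\<Phi> ` S)"
    using f(2) \<Psi>\<Phi> by (auto simp: inj_on_def g_def) (metis)
  ultimately have "openin (Euclidean_space n) (g ` \<Phi> ` S)"
    by (rule invariance_of_domain_Euclidean_space[OF op])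
  moreover have "g ` \<Phi> ` S = \<Phi> ` f ` S" using \<Psi>\<Phi> by (auto simp: g_def image_iff)
  ultimately show ?thesis
    using homeomorphic_map_openness_eq[OF hm, of "f ` S"] by auto
qed

section \<open>Mean value estimates\<close>

text \<open>On the compact set the derivatives are bounded in each of the finitely many directions
  of \<open>B\<close>, hence in operator norm; the mean value inequality on the convex set
  finishes.\<close>

lemma C1_Lipschitz_on_compact_convex:
  fixes f :: "'e::{real_normed_vector, heine_borel} \<Rightarrow> 'f::real_normed_vector"
  assumes "finite (B :: 'e set)" "span B = UNIV" "Cn_on (Suc 0) f S"
    and K: "compact K" "convex K" "K \<subseteq> S"
  obtains L where "L \<ge> 0" "\<And>x y. x \<in> K \<Longrightarrow> y \<in> K \<Longrightarrow> norm (f x - f y) \<le> L * norm (x - y)"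
proof -
  define D where "D x = frechet_derivative f (at x)" for x
  have der: "(f has_derivative D x) (at x)" if "x \<in> S" for x
    using assms(3) that by (auto simp: D_def frechet_derivative_works[symmetric])
  have cont: "continuous_on K (\<lambda>x. D x v)" for v
    using assms(3) K(3) by (auto simp: D_def intro: continuous_on_subset)
  have "\<exists>c. \<forall>x\<in>K. norm (D x b) \<le> c" for b
    using compact_imp_bounded[OF compact_continuous_image[OF cont K(1)]]
    by (fastforce simp: bounded_iff)
  then obtain c where c: "\<And>b x. x \<in> K \<Longrightarrow> norm (D x b) \<le> c b" by metis
  define C where "C = (\<Sum>b\<in>B. \<bar>c b\<bar>)"
  have C0: "C \<ge> 0" by (simp add: C_def sum_nonneg)
  have C: "norm (D x b) \<le> C" if "b \<in> B" "x \<in> K" for b x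
  proof -
    have "norm (D x b) \<le> \<bar>c b\<bar>" using c[OF that(2), of b] by simp
    also have "\<dots> \<le> C" unfolding C_def using assms(1) that(1)
      by (intro member_le_sum) auto
    finally show ?thesis .
  qed
  obtain M where M: "M \<ge> 0" "\<And>f :: 'e \<Rightarrow> 'f. \<And>C. C \<ge> 0 \<Longrightarrow> linear f \<Longrightarrow>
           (\<forall>b\<in>B. norm (f b) \<le> C) \<Longrightarrow> (\<forall>v. norm (f v) \<le> C * M * norm v)"
    using linear_bound_of_spanning[OF assms(1,2)] by metis
  have on: "onorm (D x) \<le> C * M" if "x \<in> K" for x
  proof (rule onorm_bound)
    have "linear (D x)" using der that K(3) has_derivative_linear by blast
    then show "norm (D x v) \<le> C * M * norm v" for v
      using M(2)[OF C0] C that by blast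
  qed (use C0 M in simp)
  have "norm (f x - f y) \<le> C * M * norm (x - y)" if "x \<in> K" "y \<in> K" for x y
    by (rule differentiable_bound[OF K(2) _ on that])
      (use der K(3) in \<open>auto intro: has_derivative_at_withinI\<close>)
  then show ?thesis using that[of "C * M"] C0 M by simp
qed

text \<open>The increment \<open>m (p, q) - m (a, q)\<close> is differentiated in \<open>q\<close>.
  Its derivative is a difference of partial derivatives of \<open>m\<close>, which are Lipschitz, so
  it is at most a constant times \<open>norm (p - a)\<close>; the mean value inequality adds the
  factor \<open>norm (q - a)\<close>.\<close>

lemma C2_mixed_difference_bound:
  fixes m :: "'e::{real_normed_vector, heine_borel} \<times> 'e \<Rightarrow> 'f::real_normed_vector"
  assumes "finite (B :: 'e set)" "span B = UNIV" "Cn_on (Suc (Suc 0)) m S"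
    and S: "cball a r \<times> cball a r \<subseteq> S"
  obtains C where "C \<ge> 0" "\<And>p q. p \<in> cball a r \<Longrightarrow> q \<in> cball a r \<Longrightarrow>
      norm (m (p, q) - m (p, a) - m (a, q) + m (a, a)) \<le> C * norm (p - a) * norm (q - a)"
proof (cases "r \<ge> 0")
  case False
  then show ?thesis using that[of 0] by simp
next
  case True
  then have a: "a \<in> cball a r" by simp
  define P where "P = (\<lambda>b::'e. (b, 0::'e)) ` B \<union> (\<lambda>c. (0, c)) ` B"
  have P: "finite P" "span P = UNIV"
    using assms(1,2) span_Times_UNIV[of B B] by (auto simp: P_def)
  define h where "h v x = frechet_derivative m (at x) (0, v)" for v x
  have der: "(m has_derivative frechet_derivative m (at x)) (at x)" if "x \<in> S" for x
    using assms(3) that by (auto simp: frechet_derivative_works[symmetric])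
  have "Cn_on (Suc 0) (h v) S" for v
    using assms(3) unfolding h_def by simp
  then have "\<exists>L\<ge>0. \<forall>x\<in>cball a r \<times> cball a r. \<forall>y\<in>cball a r \<times> cball a r.
      norm (h v x - h v y) \<le> L * norm (x - y)" for v
    using C1_Lipschitz_on_compact_convex[OF P, of "h v" S "cball a r \<times> cball a r"] S
    by (metis compact_cball convex_cball compact_Times convex_Times)
  then obtain L where L: "\<And>v. L v \<ge> 0" "\<And>v x y. x \<in> cball a r \<times> cball a r \<Longrightarrow> y \<in> cball a r \<times> cball a r \<Longrightarrow>
      norm (h v x - h v y) \<le> L v * norm (x - y)" by metis
  define C where "C = (\<Sum>b\<in>B. L b)"
  have C0: "C \<ge> 0" by (simp add: C_def sum_nonneg L(1))
  have C: "norm (h b (p, q) - h b (a, q)) \<le> C * norm (p - a)"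
    if "b \<in> B" "p \<in> cball a r" "q \<in> cball a r" for b p q
  proof -
    have "norm (h b (p, q) - h b (a, q)) \<le> L b * norm ((p, q) - (a, q))"
      using that a by (intro L(2)) auto
    also have "\<dots> = L b * norm (p - a)" by (simp add: norm_Pair)
    also have "\<dots> \<le> C * norm (p - a)" unfolding C_def using assms(1) that(1) L(1)
      by (intro mult_right_mono member_le_sum) auto
    finally show ?thesis .
  qed
  obtain M where M: "M \<ge> 0" "\<And>f :: 'e \<Rightarrow> 'f. \<And>C. C \<ge> 0 \<Longrightarrow> linear f \<Longrightarrow>
           (\<forall>b\<in>B. norm (f b) \<le> C) \<Longrightarrow> (\<forall>v. norm (f v) \<le> C * M * norm v)"
    using linear_bound_of_spanning[OF assms(1,2)] by metis
  have "norm (m (p, q) - m (p, a) - m (a, q) + m (a, a)) \<le> C * M * norm (p - a) * norm (q - a)"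
    if p: "p \<in> cball a r" and q: "q \<in> cball a r" for p q
  proof -
    define g where "g q = m (p, q) - m (a, q)" for q
    define g' where "g' q v = h v (p, q) - h v (a, q)" for q v
    have dg1: "((\<lambda>q. m (u, q)) has_derivative (\<lambda>v. h v (u, q))) (at q)"
      if "u \<in> cball a r" "q \<in> cball a r" for u q
    proof -
      have "((\<lambda>q. (u, q)) has_derivative (\<lambda>v. (0, v))) (at q)"
        by (auto intro!: derivative_eq_intros)
      moreover have "(m has_derivative frechet_derivative m (at (u, q))) (at (u, q))"
        using der S that by blast
      ultimately show ?thesis
        unfolding h_def by (rule has_derivative_compose)
    qed
    have dg: "(g has_derivative g' q) (at q)" if "q \<in> cball a r" for q
      unfolding g_def g'_def by (intro has_derivative_diff dg1 p a that)
    have on: "onorm (g' q) \<le> C * norm (p - a) * M" if "q \<in> cball a r" for q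
    proof (rule onorm_bound)
      have "linear (g' q)" using dg that has_derivative_linear by blast
      then show "norm (g' q v) \<le> C * norm (p - a) * M * norm v" for v
        using M(2)[of "C * norm (p - a)" "g' q"] C0 C p that by (simp add: g'_def)
    qed (use C0 M in simp)
    have "norm (g q - g a) \<le> C * norm (p - a) * M * norm (q - a)"
      by (rule differentiable_bound[OF convex_cball _ on q a])
        (use dg in \<open>auto intro: has_derivative_at_withinI\<close>)
    then show ?thesis by (simp add: g_def algebra_simps)
  qed
  then show ?thesis using that[of "C * M"] C0 M by simp
qed

section \<open>Positively expansive endomorphisms and shadowing\<close>

text \<open>A finite intersection from a decreasing sequence contains a member of the sequence, so
  the finite intersection property of \<open>K\<close> applies; the \<open>C n\<close> themselves
  may leave \<open>K\<close>.\<close>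

lemma compactin_nested_Inter:
  assumes K: "compactin T K" and cl: "\<And>n::nat. closedin T (C n)" and ne: "\<And>n. C n \<inter> K \<noteq> {}"
    and dec: "\<And>n. C (Suc n) \<subseteq> C n"
  obtains x where "x \<in> K" "\<And>n. x \<in> C n"
proof -
  have mono: "C n \<subseteq> C m" if "m \<le> n" for m n
    using lift_Suc_antimono_le[of C, OF dec that] .
  have "K \<inter> \<Inter> (range C) \<noteq> {}"
  proof (rule compactin_fip[THEN iffD1, OF K, THEN conjunct2, rule_format, OF conjI])
    show "\<forall>U\<in>range C. closedin T U" using cl by auto
    show "\<forall>\<F>. finite \<F> \<and> \<F> \<subseteq> range C \<longrightarrow> K \<inter> \<Inter> \<F> \<noteq> {}"
    proof (intro allI impI)
      fix \<F> assume "finite \<F> \<and> \<F> \<subseteq> range C"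
      then obtain I where I: "finite I" "\<F> = C ` I"
        by (meson finite_subset_image)
      then obtain m where "\<forall>i\<in>I. i \<le> m" using finite_nat_set_iff_bounded_le by blast
      then have "C m \<subseteq> \<Inter> \<F>" using I mono by blast
      then show "K \<inter> \<Inter> \<F> \<noteq> {}" using ne[of m] by blast
    qed
  qed
  then show ?thesis using that by blast
qed

section \<open>Neighbourhoods of the identity\<close>

context topological_group
begin

abbreviation nbhd where "nbhd \<equiv> neighbourhood_of T \<one>"

lemma nbhd_subset: "nbhd U \<Longrightarrow> U \<subseteq> carrier G"
  by (simp add: neighbourhood_of_def topspace_eq)

lemma nbhd_one: "nbhd U \<Longrightarrow> \<one> \<in> U"
  by (auto simp: neighbourhood_of_def)

lemma nbhd_mono: "nbhd U \<Longrightarrow> U \<subseteq> V \<Longrightarrow> V \<subseteq> carrier G \<Longrightarrow> nbhd V"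
  by (fastforce simp: neighbourhood_of_def topspace_eq)

lemma nbhd_openin: "openin T U \<Longrightarrow> \<one> \<in> U \<Longrightarrow> nbhd U"
  by (auto simp: neighbourhood_of_def dest: openin_subset)

lemma nbhd_Int: "nbhd U \<Longrightarrow> nbhd V \<Longrightarrow> nbhd (U \<inter> V)"
  unfolding neighbourhood_of_def by (meson IntI Int_mono le_infI1 openin_Int)

lemma nbhd_preimage:
  assumes "continuous_map T T f" "f \<one> = \<one>" "nbhd U"
  shows "nbhd {x \<in> carrier G. f x \<in> U}"
proof -
  obtain W where W: "openin T W" "\<one> \<in> W" "W \<subseteq> U"
    using assms(3) by (auto simp: neighbourhood_of_def)
  then have "nbhd {x \<in> topspace T. f x \<in> W}"
    using openin_continuous_map_preimage[OF assms(1) W(1)] assms(2)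
    by (intro nbhd_openin) (auto simp: topspace_eq)
  then show ?thesis by (rule nbhd_mono) (use W topspace_eq in auto)
qed

lemma nbhd_mult:
  assumes "nbhd U"
  obtains V where "nbhd V" "\<And>x y. x \<in> V \<Longrightarrow> y \<in> V \<Longrightarrow> x \<otimes> y \<in> U"
proof -
  obtain W where W: "openin T W" "\<one> \<in> W" "W \<subseteq> U"
    using assms by (auto simp: neighbourhood_of_def)
  define M where "M = {z \<in> topspace (prod_topology T T). (case z of (x, y) \<Rightarrow> x \<otimes> y) \<in> W}"
  have op: "openin (prod_topology T T) M"
    unfolding M_def by (rule openin_continuous_map_preimage[OF continuous_mult W(1)])
  have one: "(\<one>, \<one>) \<in> M" using W(2) by (simp add: M_def topspace_eq)
  from openin_prod_topology_alt[THEN iffD1, OF op, rule_format, OF one]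
  obtain A B where AB: "openin T A" "openin T B" "\<one> \<in> A" "\<one> \<in> B" "A \<times> B \<subseteq> M"
    by (elim exE conjE)
  have "nbhd (A \<inter> B)" using AB by (intro nbhd_Int nbhd_openin)
  moreover have "x \<otimes> y \<in> U" if "x \<in> A \<inter> B" "y \<in> A \<inter> B" for x y
  proof -
    have "(x, y) \<in> M" using AB(5) that by blast
    then show ?thesis using W(3) by (auto simp: M_def)
  qed
  ultimately show ?thesis by (rule that)
qed

lemma nbhd_inv: "nbhd U \<Longrightarrow> nbhd {x \<in> carrier G. inv x \<in> U}"
  using continuous_inv by (intro nbhd_preimage) auto

lemma continuous_map_binary_mult:
  assumes "continuous_map Z T f" "continuous_map Z T g"
  shows "continuous_map Z T (\<lambda>x. f x \<otimes> g x)"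
  using continuous_map_compose[OF continuous_map_pairedI[OF assms] continuous_mult]
  by (simp add: o_def)

lemma continuous_map_binary_inv:
  assumes "continuous_map Z T f"
  shows "continuous_map Z T (\<lambda>x. inv (f x))"
  using continuous_map_compose[OF assms continuous_inv] by (simp add: o_def)

text \<open>Expansiveness recognises only \<open>\<one>\<close>, so equality of two products is
  tested on their quotient. Setting some factors to \<open>\<one>\<close> gives quotients of fewer
  elements.\<close>

lemma nbhd_double_quotient:
  assumes "nbhd P"
  obtains V where "nbhd V" "\<And>a b c d. \<lbrakk>a \<in> V; b \<in> V; c \<in> V; d \<in> V\<rbrakk> \<Longrightarrow> inv (a \<otimes> b) \<otimes> (c \<otimes> d) \<in> P"
proof -
  obtain V1 where V1: "nbhd V1" "\<And>x y. x \<in> V1 \<Longrightarrow> y \<in> V1 \<Longrightarrow> x \<otimes> y \<in> P"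
    by (rule nbhd_mult[OF assms]) blast
  obtain V2 where V2: "nbhd V2" "\<And>x y. x \<in> V2 \<Longrightarrow> y \<in> V2 \<Longrightarrow> x \<otimes> y \<in> V1 \<inter> {x \<in> carrier G. inv x \<in> V1}"
    by (rule nbhd_mult[OF nbhd_Int[OF V1(1) nbhd_inv[OF V1(1)]]]) blast
  show ?thesis
  proof (rule that[OF V2(1)])
    fix a b c d assume "a \<in> V2" "b \<in> V2" "c \<in> V2" "d \<in> V2"
    then have "inv (a \<otimes> b) \<in> V1" "c \<otimes> d \<in> V1" using V2(2) by auto
    then show "inv (a \<otimes> b) \<otimes> (c \<otimes> d) \<in> P" by (rule V1(2))
  qed
qed

end

section \<open>Dynamical balls and the expanding filtration\<close>

locale topological_group_endo = topological_group +
  fixes \<alpha>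
  assumes hom: "\<alpha> \<in> hom G G" and continuous_endo: "continuous_map T T \<alpha>"
begin

lemma pow_hom: "\<alpha> ^^ n \<in> hom G G"
  by (induction n) (use hom in \<open>auto simp: hom_def Pi_def\<close>)

lemma pow_closed [simp]: "x \<in> carrier G \<Longrightarrow> (\<alpha> ^^ n) x \<in> carrier G"
  using pow_hom by (auto simp: hom_def)

lemma pow_mult: "x \<in> carrier G \<Longrightarrow> y \<in> carrier G \<Longrightarrow> (\<alpha> ^^ n) (x \<otimes> y) = (\<alpha> ^^ n) x \<otimes> (\<alpha> ^^ n) y"
  using pow_hom by (auto simp: hom_def)

lemma pow_group_hom: "group_hom G G (\<alpha> ^^ n)"
  by (simp add: group_hom_def group_hom_axioms_def is_group pow_hom)

lemma pow_one [simp]: "(\<alpha> ^^ n) \<one> = \<one>"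
  using group_hom.hom_one[OF pow_group_hom] .

lemma pow_inv: "x \<in> carrier G \<Longrightarrow> (\<alpha> ^^ n) (inv x) = inv ((\<alpha> ^^ n) x)"
  using group_hom.hom_inv[OF pow_group_hom] .

lemma pow_continuous: "continuous_map T T (\<alpha> ^^ n)"
  by (induction n) (auto intro: continuous_map_compose[OF _ continuous_endo, unfolded o_def] simp: o_def)

lemmas endo_closed [simp] = pow_closed[of _ 1, simplified]
lemmas endo_mult = pow_mult[of _ _ 1, simplified]
lemmas endo_one [simp] = pow_one[of 1, simplified]
lemmas endo_inv = pow_inv[of _ 1, simplified]

text \<open>A dynamical (Bowen) ball at \<open>\<one>\<close>. If \<open>K\<close> lies in an
  expansive neighbourhood, the intersection over \<open>n\<close> contains at most
  \<open>\<one>\<close>.\<close>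

definition stay :: "'a set \<Rightarrow> nat \<Rightarrow> 'a set" where
  "stay K n = {x \<in> carrier G. \<forall>i\<le>n. (\<alpha> ^^ i) x \<in> K}"

lemma stay_Suc: "stay K (Suc n) = {x \<in> carrier G. x \<in> K \<and> \<alpha> x \<in> stay K n}"
proof -
  have "(\<forall>i\<le>Suc n. (\<alpha> ^^ i) x \<in> K) \<longleftrightarrow> x \<in> K \<and> (\<forall>i\<le>n. (\<alpha> ^^ i) (\<alpha> x) \<in> K)" for x
    using All_less_Suc2[of "Suc n" "\<lambda>i. (\<alpha> ^^ i) x \<in> K"]
    by (simp add: less_Suc_eq_le funpow_swap1)
  then show ?thesis by (auto simp: stay_def)
qed

lemma stay_antimono: "m \<le> n \<Longrightarrow> stay K n \<subseteq> stay K m"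
  by (auto simp: stay_def)

lemma nbhd_stay: "nbhd K \<Longrightarrow> nbhd (stay K n)"
proof (induction n)
  case 0
  then show ?case using nbhd_subset by (auto simp: stay_def Int_absorb1 intro: nbhd_mono)
next
  case (Suc n)
  have "stay K (Suc n) = K \<inter> {x \<in> carrier G. \<alpha> x \<in> stay K n}"
    using nbhd_subset[OF Suc.prems] by (auto simp: stay_Suc)
  then show ?case
    using Suc nbhd_preimage[OF continuous_endo] by (simp add: nbhd_Int)
qed

lemma closedin_stay: "closedin T K \<Longrightarrow> closedin T (stay K n)"
proof -
  assume K: "closedin T K"
  have "closedin T (\<Inter>i\<in>{..n}. {x \<in> topspace T. (\<alpha> ^^ i) x \<in> K})"
    by (intro closedin_Inter) (auto intro!: closedin_continuous_map_preimage pow_continuous K)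
  also have "(\<Inter>i\<in>{..n}. {x \<in> topspace T. (\<alpha> ^^ i) x \<in> K}) = stay K n"
    by (auto simp: stay_def topspace_eq)
  finally show ?thesis .
qed

text \<open>Otherwise the closed sets \<open>stay K n - V\<close>, with
  \<open>V \<subseteq> W\<close> open around \<open>\<one>\<close>, are nonempty and decreasing
  inside the compact \<open>K\<close>. A common point would be \<open>\<one>\<close>, which lies in
  \<open>V\<close>.\<close>

lemma stay_shrinks:
  assumes K: "compactin T K" and triv: "(\<Inter>n. stay K n) \<subseteq> {\<one>}" and W: "nbhd W"
  obtains n where "stay K n \<subseteq> W"
proof (rule ccontr)
  assume "\<not> thesis"
  with that have no: "\<And>n. \<not> stay K n \<subseteq> W" by blast
  obtain V where V: "openin T V" "\<one> \<in> V" "V \<subseteq> W"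
    using W by (auto simp: neighbourhood_of_def)
  have cl: "closedin T K" using K Hausdorff by (rule compactin_imp_closedin[rotated])
  obtain x where x: "x \<in> K" "\<And>n. x \<in> stay K n - V"
  proof (rule compactin_nested_Inter[OF K, of "\<lambda>n. stay K n - V"])
    show "closedin T (stay K n - V)" for n
      by (intro closedin_diff closedin_stay cl V)
    have "stay K n \<subseteq> K" for n by (auto simp: stay_def)
    then show "(stay K n - V) \<inter> K \<noteq> {}" for n using no[of n] V(3) by blast
    show "stay K (Suc n) - V \<subseteq> stay K n - V" for n using stay_antimono[of n "Suc n" K] by auto
  qed blast
  then have "x = \<one>" using triv by blast
  then show False using x V(2) by blast
qed

text \<open>From time \<open>M\<close> on the orbit rests at \<open>\<one>\<close>, so it lies in
  \<open>P\<close> at all times as soon as it does so before \<open>M\<close>.\<close>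

lemma kernel_trivial:
  assumes "(\<Inter>n. {x \<in> carrier G. (\<alpha> ^^ n) x \<in> P}) = {\<one>}" "x \<in> carrier G"
    and "(\<alpha> ^^ M) x = \<one>" "\<And>i. i < M \<Longrightarrow> (\<alpha> ^^ i) x \<in> P"
  shows "x = \<one>"
proof -
  have "\<one> \<in> (\<Inter>n. {x \<in> carrier G. (\<alpha> ^^ n) x \<in> P})" using assms(1) by simp
  then have "\<one> \<in> P" by auto
  have "(\<alpha> ^^ i) x \<in> P" for i
  proof (cases "i < M")
    case False
    then have "(\<alpha> ^^ i) x = (\<alpha> ^^ (i - M)) ((\<alpha> ^^ M) x)"
      by (metis add.commute comp_apply funpow_add le_add_diff_inverse not_less)
    then show ?thesis using assms(3) \<open>\<one> \<in> P\<close> by simp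
  qed (use assms in simp)
  then have "x \<in> (\<Inter>n. {x \<in> carrier G. (\<alpha> ^^ n) x \<in> P})" using assms(2) by blast
  then show ?thesis using assms(1) by simp
qed

lemma inv_mult_one_iff: "x \<in> carrier G \<Longrightarrow> y \<in> carrier G \<Longrightarrow> inv x \<otimes> y = \<one> \<longleftrightarrow> x = y"
  by (metis inv_solve_left' one_closed r_one)

text \<open>Two points with the same image have a quotient in the kernel of \<alpha>. If the points
  are close to \<open>\<one>\<close>, this quotient, and hence its whole orbit, lies in
  \<open>P\<close>.\<close>

lemma locally_injective_of_expansive:
  assumes "positively_expansive G T \<alpha>"
  obtains V where "nbhd V" "inj_on \<alpha> V"
proof -
  obtain P where P: "nbhd P" "(\<Inter>n. {x \<in> carrier G. (\<alpha> ^^ n) x \<in> P}) = {\<one>}"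
    using assms by (auto simp: positively_expansive_def)
  obtain V where V: "nbhd V" "\<And>a b c d. \<lbrakk>a \<in> V; b \<in> V; c \<in> V; d \<in> V\<rbrakk> \<Longrightarrow> inv (a \<otimes> b) \<otimes> (c \<otimes> d) \<in> P"
    by (rule nbhd_double_quotient[OF P(1)]) blast
  have "x = y" if "x \<in> V" "y \<in> V" "\<alpha> x = \<alpha> y" for x y
  proof -
    have xy: "x \<in> carrier G" "y \<in> carrier G" using that nbhd_subset[OF V(1)] by auto
    have P': "inv x \<otimes> y \<in> P"
      using V(2)[OF that(1) nbhd_one[OF V(1)] that(2) nbhd_one[OF V(1)]] xy by simp
    have "inv x \<otimes> y = \<one>"
      by (rule kernel_trivial[OF P(2), where M = 1])
        (use P' xy that(3) in \<open>auto simp: endo_mult endo_inv\<close>)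
    then show ?thesis using inv_mult_one_iff[OF xy] by simp
  qed
  then show ?thesis using that[OF V(1)] by (simp add: inj_on_def)
qed

text \<open>With \<open>P\<close> an expansive neighbourhood, \<open>U n\<close> below consists of the points that stay in a small
  compact neighbourhood for \<open>n + const\<close> steps. These sets shrink to \<open>\<one>\<close> by compactness, and
  \<open>\<alpha>\<close> maps each of them onto the previous one.\<close>

lemma expanding_filtration:
  assumes exp: "positively_expansive G T \<alpha>"
    and lc: "\<And>W. nbhd W \<Longrightarrow> \<exists>K. nbhd K \<and> compactin T K \<and> K \<subseteq> W"
    and op: "\<And>W. nbhd W \<Longrightarrow> nbhd (\<alpha> ` W)"
    and W: "nbhd W"
  obtains U where "\<And>n. nbhd (U n)" "\<And>n. compactin T (U n)" "\<And>n. U n \<subseteq> W"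
    "\<And>n. U (Suc n) \<subseteq> U n" "\<And>V. nbhd V \<Longrightarrow> \<exists>n. U n \<subseteq> V" "\<And>n. \<alpha> ` U (Suc n) = U n"
    "\<And>a b c M. \<lbrakk>a \<in> U M; b \<in> U M; c \<in> U M; (\<alpha> ^^ M) (a \<otimes> b) = (\<alpha> ^^ M) c\<rbrakk> \<Longrightarrow> a \<otimes> b = c"
proof -
  obtain P where P: "nbhd P" "(\<Inter>n. {x \<in> carrier G. (\<alpha> ^^ n) x \<in> P}) = {\<one>}"
    using exp by (auto simp: positively_expansive_def)
  obtain V where V: "nbhd V" "\<And>a b c d. \<lbrakk>a \<in> V; b \<in> V; c \<in> V; d \<in> V\<rbrakk> \<Longrightarrow> inv (a \<otimes> b) \<otimes> (c \<otimes> d) \<in> P"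
    by (rule nbhd_double_quotient[OF P(1)]) blast
  obtain K where K: "nbhd K" "compactin T K" "K \<subseteq> V \<inter> W"
    using lc[OF nbhd_Int[OF V(1) W]] by blast
  note KG = nbhd_subset[OF K(1)] and K1 = nbhd_one[OF K(1)]
  have KP: "inv (a \<otimes> b) \<otimes> (c \<otimes> d) \<in> P" if "a \<in> K" "b \<in> K" "c \<in> K" "d \<in> K" for a b c d
    using that K(3) V(2) by blast
  have "K \<subseteq> P"
  proof
    fix x assume "x \<in> K"
    then show "x \<in> P" using KP[OF K1 K1 _ K1, of x] KG by auto
  qed
  then have "(\<Inter>n. stay K n) \<subseteq> (\<Inter>n. {x \<in> carrier G. (\<alpha> ^^ n) x \<in> P})"
    by (auto simp: stay_def)
  then have triv: "(\<Inter>n. stay K n) \<subseteq> {\<one>}" using P(2) by simp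
  \<comment> \<open>The image of \<open>K\<close> under \<alpha> is a neighbourhood, so points that
    stay for \<open>N\<close> steps have a preimage in \<open>K\<close>. The shift of time by
    \<open>N\<close> makes this available at every level of \<open>U\<close>.\<close>
  obtain N where N: "stay K N \<subseteq> \<alpha> ` K" using stay_shrinks[OF K(2) triv op[OF K(1)]] .
  define U where "U n = stay K (n + N)" for n
  have UK: "U n \<subseteq> K" for n by (auto simp: U_def stay_def)
  have img: "\<alpha> ` U (Suc n) = U n" for n
  proof
    show "\<alpha> ` U (Suc n) \<subseteq> U n" by (auto simp: U_def stay_Suc)
    show "U n \<subseteq> \<alpha> ` U (Suc n)"
    proof
      fix y assume y: "y \<in> U n"
      then have "y \<in> stay K N" using stay_antimono[of N "n + N"] by (auto simp: U_def)
      then obtain x where "x \<in> K" "y = \<alpha> x" using N by auto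
      then show "y \<in> \<alpha> ` U (Suc n)" using y KG by (auto simp: U_def stay_Suc)
    qed
  qed
  have cancel: "a \<otimes> b = c"
    if abc: "a \<in> U M" "b \<in> U M" "c \<in> U M" and eq: "(\<alpha> ^^ M) (a \<otimes> b) = (\<alpha> ^^ M) c" for a b c M
  proof -
    have car: "a \<in> carrier G" "b \<in> carrier G" "c \<in> carrier G" using abc UK KG by auto
    have K': "(\<alpha> ^^ i) a \<in> K" "(\<alpha> ^^ i) b \<in> K" "(\<alpha> ^^ i) c \<in> K" if "i < M" for i
      using abc that by (auto simp: U_def stay_def)
    \<comment> \<open>The orbits of \<open>a\<close>, \<open>b\<close> and \<open>c\<close> are in
      \<open>K\<close> before time \<open>M\<close>, so the choice of \<open>K\<close> keeps the
      iterates of the quotient in \<open>P\<close>.\<close>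
    have "inv (a \<otimes> b) \<otimes> c = \<one>"
    proof (rule kernel_trivial[OF P(2), where M = M])
      show "(\<alpha> ^^ M) (inv (a \<otimes> b) \<otimes> c) = \<one>"
        using car eq by (simp add: pow_mult[of "inv (a \<otimes> b)"] pow_inv)
      show "(\<alpha> ^^ i) (inv (a \<otimes> b) \<otimes> c) \<in> P" if "i < M" for i
        using KP[OF K'[OF that] K1] car by (simp add: pow_mult pow_inv)
    qed (use car in simp)
    then show ?thesis using car by (simp add: inv_mult_one_iff)
  qed
  have small: "\<exists>n. U n \<subseteq> V" if "nbhd V" for V
  proof -
    obtain n where "stay K n \<subseteq> V" using stay_shrinks[OF K(2) triv \<open>nbhd V\<close>] .
    then show ?thesis using stay_antimono[of n "n + N" K] by (auto simp: U_def)
  qed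
  have dec: "U (Suc n) \<subseteq> U n" for n using stay_antimono[of "n + N" "Suc n + N" K] by (simp add: U_def)
  have comp: "compactin T (U n)" for n
    using K(2) UK Hausdorff unfolding U_def
    by (meson U_def closed_compactin closedin_stay compactin_imp_closedin)
  have nb: "nbhd (U n)" for n by (simp add: U_def nbhd_stay K(1))
  have sub: "U n \<subseteq> W" for n using UK K(3) by blast
  show ?thesis by (rule that[of U, OF nb comp sub dec small img cancel])
qed

section \<open>Backward solution along pseudo-orbits\<close>

lemma image_pow_filtration:
  assumes "\<And>n. \<alpha> ` U (Suc n) = U n"
  shows "(\<alpha> ^^ j) ` U (n + j) = U n"
proof (induction j arbitrary: n)
  case (Suc j)
  have "(\<alpha> ^^ Suc j) ` U (n + Suc j) = (\<alpha> ^^ j) ` \<alpha> ` U (Suc (n + j))"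
    by (simp add: funpow_Suc_right image_comp del: funpow.simps(2))
  then show ?case using Suc assms by simp
qed simp

text \<open>The orbit correction accumulated in \<open>j\<close> steps by the one-step errors \<open>v\<close>: for a pseudo-orbit
  \<open>x\<close> with errors \<open>v k\<close>, \<open>x j = (\<alpha> ^^ j) (x 0) \<otimes> drift v j\<close>.\<close>

primrec drift :: "(nat \<Rightarrow> 'a) \<Rightarrow> nat \<Rightarrow> 'a" where
  "drift v 0 = \<one>"
| "drift v (Suc j) = \<alpha> (drift v j) \<otimes> v j"

text \<open>For a fixed horizon \<open>M\<close> the drift is a continuous expression in finitely
  many errors, with value \<open>\<one>\<close> when all of them are \<open>\<one>\<close>. The
  neighbourhood \<open>V\<close> depends on \<open>M\<close> but serves all error sequences.\<close>

lemma drift_small: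
  assumes "nbhd R"
  shows "\<exists>V. nbhd V \<and> (\<forall>v. (\<forall>k. v k \<in> V) \<longrightarrow> (\<forall>j\<le>M. drift v j \<in> R))"
  using assms
proof (induction M arbitrary: R)
  case 0
  then show ?case by (intro exI[of _ R]) (simp add: nbhd_one)
next
  case (Suc M)
  obtain R1 where R1: "nbhd R1" "\<And>x y. x \<in> R1 \<Longrightarrow> y \<in> R1 \<Longrightarrow> x \<otimes> y \<in> R"
    by (rule nbhd_mult[OF Suc.prems]) blast
  define R2 where "R2 = {x \<in> carrier G. \<alpha> x \<in> R1} \<inter> R"
  have "nbhd R2"
    unfolding R2_def using R1(1) Suc.prems continuous_endo by (intro nbhd_Int nbhd_preimage) auto
  from Suc.IH[OF this] obtain V
    where V: "nbhd V" "\<forall>v. (\<forall>k. v k \<in> V) \<longrightarrow> (\<forall>j\<le>M. drift v j \<in> R2)" by (elim exE conjE)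
  have "drift v j \<in> R" if v: "\<forall>k. v k \<in> V \<inter> R1" and j: "j \<le> Suc M" for v j
  proof (cases "j = Suc M")
    case True
    have "drift v M \<in> R2" using V(2)[rule_format, of v M] v by simp
    then show ?thesis using R1(2) v by (simp add: True R2_def)
  next
    case False
    then show ?thesis using V(2)[rule_format, of v j] v j by (simp add: R2_def)
  qed
  then show ?case
    by (intro exI[of _ "V \<inter> R1"] conjI nbhd_Int V(1) R1(1)) simp
qed

text \<open>Telescoping from an arbitrary time \<open>k\<close>: the shadowing argument cuts the
  pseudo-orbit into blocks of length \<open>M\<close> and needs the drift over each block.\<close>

lemma pseudo_orbit_drift:
  assumes x: "\<And>k. x k \<in> carrier G"
  shows "drift (\<lambda>i. inv (\<alpha> (x (k + i))) \<otimes> x (Suc (k + i))) j \<in> carrier G \<and>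
    x (k + j) = (\<alpha> ^^ j) (x k) \<otimes> drift (\<lambda>i. inv (\<alpha> (x (k + i))) \<otimes> x (Suc (k + i))) j"
proof (induction j)
  case (Suc j)
  let ?d = "drift (\<lambda>i. inv (\<alpha> (x (k + i))) \<otimes> x (Suc (k + i)))"
  have d: "?d j \<in> carrier G" and e: "x (k + j) = (\<alpha> ^^ j) (x k) \<otimes> ?d j"
    using Suc by auto
  have "\<alpha> (x (k + j)) = (\<alpha> ^^ Suc j) (x k) \<otimes> \<alpha> (?d j)"
    by (subst e) (simp add: endo_mult d x)
  moreover have "x (k + Suc j) = \<alpha> (x (k + j)) \<otimes> (inv (\<alpha> (x (k + j))) \<otimes> x (Suc (k + j)))"
    using x by (simp add: m_assoc[symmetric])
  ultimately show ?case using d x by (simp add: m_assoc)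
qed (use x in simp)

text \<open>Applying \<open>\<alpha> ^^ M\<close> to the error at the start of a block and
  multiplying by the drift gives the error at its end. Since \<open>\<alpha> ^^ M\<close> maps
  \<open>D = U M\<close> onto \<open>U 0\<close>, an end error in \<open>D\<close> comes from a
  start error in \<open>D\<close>. Finitely many blocks are solved from the last to the first,
  infinitely many by compactness.\<close>

theorem shadowing_of_expansive:
  assumes exp: "positively_expansive G T \<alpha>"
    and lc: "\<And>W. nbhd W \<Longrightarrow> \<exists>K. nbhd K \<and> compactin T K \<and> K \<subseteq> W"
    and op: "\<And>W. nbhd W \<Longrightarrow> nbhd (\<alpha> ` W)"
  shows "has_shadowing G T \<alpha>"
  unfolding has_shadowing_def
proof (intro allI impI)
  fix U0 assume U0: "nbhd U0"
  obtain W where W: "nbhd W" "\<And>x y. x \<in> W \<Longrightarrow> y \<in> W \<Longrightarrow> x \<otimes> y \<in> U0"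
    by (rule nbhd_mult[OF U0]) blast
  obtain U where U: "\<And>n. nbhd (U n)" "\<And>n. compactin T (U n)" "\<And>n. U n \<subseteq> W"
    "\<And>n. U (Suc n) \<subseteq> U n" "\<And>V. nbhd V \<Longrightarrow> \<exists>n. U n \<subseteq> V" "\<And>n. \<alpha> ` U (Suc n) = U n"
    by (rule expanding_filtration[OF exp _ _ W(1)], erule lc, erule op) (rule that; assumption)
  have mono: "U n \<subseteq> U m" if "m \<le> n" for m n
    using lift_Suc_antimono_le[of U, OF U(4) that] .
  note im = image_pow_filtration[of U, OF U(6)]
  obtain Y where Y: "nbhd Y" "\<And>x y. x \<in> Y \<Longrightarrow> y \<in> Y \<Longrightarrow> x \<otimes> y \<in> U 0"
    by (rule nbhd_mult[OF U(1)]) blast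
  obtain M0 where "U M0 \<subseteq> Y" using U(5)[OF Y(1)] by blast
  \<comment> \<open>The successor makes \<open>M\<close> positive, as required for dividing times by
    \<open>M\<close>.\<close>
  define M where "M = Suc M0"
  have M: "U M \<subseteq> Y" "M > 0" using mono[of M0 M] \<open>U M0 \<subseteq> Y\<close> by (auto simp: M_def)
  define D where "D = U M"
  have D: "D \<subseteq> carrier G" "compactin T D" "D \<subseteq> Y"
    using U M nbhd_subset by (auto simp: D_def)
  define R where "R = W \<inter> {x \<in> carrier G. inv x \<in> Y}"
  have "nbhd R" unfolding R_def using W(1) Y(1) by (intro nbhd_Int nbhd_inv)
  from drift_small[OF this, of M] obtain V
    where V: "nbhd V" "\<forall>v. (\<forall>k. v k \<in> V) \<longrightarrow> (\<forall>j\<le>M. drift v j \<in> R)" by (elim exE conjE)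
  have "\<exists>z\<in>carrier G. shadowed_by G \<alpha> U0 x z" if po: "pseudo_orbit G \<alpha> V x" for x
  proof -
    have x: "x k \<in> carrier G" for k using po by (simp add: pseudo_orbit_def)
    define w where "w k = drift (\<lambda>i. inv (\<alpha> (x (k + i))) \<otimes> x (Suc (k + i)))" for k
    have wR: "w k j \<in> R" if "j \<le> M" for k j
      unfolding w_def using po that by (intro V(2)[rule_format]) (auto simp: pseudo_orbit_def)
    have w: "w k j \<in> carrier G" "x (k + j) = (\<alpha> ^^ j) (x k) \<otimes> w k j" for k j
      unfolding w_def using pseudo_orbit_drift[of x, OF x] by blast+
    define y where "y k z i = inv ((\<alpha> ^^ (i * M)) z) \<otimes> x (k + i * M)" for k z i
    have ex: "\<exists>z\<in>carrier G. \<forall>i\<le>n. y k z i \<in> D" for n k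
    proof (induction n arbitrary: k)
      case 0
      have "y k (x k) 0 = \<one>" using x by (simp add: y_def)
      then show ?case using x U(1) nbhd_one by (auto simp: D_def intro!: bexI[of _ "x k"])
    next
      case (Suc n)
      obtain z' where z': "z' \<in> carrier G" "\<And>i. i \<le> n \<Longrightarrow> y (k + M) z' i \<in> D"
        using Suc.IH by blast
      define y' where "y' = inv z' \<otimes> x (k + M)"
      have y': "y' \<in> D" "y' \<in> carrier G" using z'(2)[of 0] z'(1) x by (auto simp: y'_def y_def)
      \<comment> \<open>This product must be the image under \<open>\<alpha> ^^ M\<close> of the
        error wanted at time \<open>k\<close>. Both factors lie in \<open>Y\<close>, so that error
        is found in \<open>D\<close>.\<close>
      have "y' \<otimes> inv (w k M) \<in> U 0"
        using y' D(3) wR[of M k] by (intro Y(2)) (auto simp: R_def)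
      then have "y' \<otimes> inv (w k M) \<in> (\<alpha> ^^ M) ` D" using im[of M 0] by (simp add: D_def)
      then obtain u where u: "u \<in> D" "(\<alpha> ^^ M) u = y' \<otimes> inv (w k M)" by auto
      have uG: "u \<in> carrier G" using u D by auto
      define z where "z = x k \<otimes> inv u"
      have zG: "z \<in> carrier G" using x uG by (simp add: z_def)
      have "(\<alpha> ^^ M) z = (\<alpha> ^^ M) (x k) \<otimes> inv (y' \<otimes> inv (w k M))"
        by (simp add: z_def pow_mult pow_inv x uG u(2))
      also have "\<dots> = x (k + M) \<otimes> inv y'"
        using w y' x by (simp add: inv_mult_group m_assoc)
      also have "\<dots> = z'"
        using x z'(1) by (simp add: y'_def inv_mult_group m_assoc[symmetric])
      finally have zz: "(\<alpha> ^^ M) z = z'" .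
      have "y k z i \<in> D" if "i \<le> Suc n" for i
      proof (cases i)
        case 0
        then show ?thesis using u x uG by (simp add: y_def z_def inv_mult_group m_assoc)
      next
        case (Suc i')
        have "(\<alpha> ^^ (i * M)) z = (\<alpha> ^^ (i' * M)) ((\<alpha> ^^ M) z)"
          using funpow_add[of "i' * M" M \<alpha>] by (simp add: Suc add.commute)
        then have "y k z i = y (k + M) z' i'" by (simp add: y_def zz Suc add.assoc)
        then show ?thesis using z'(2) that Suc by simp
      qed
      then show ?case using zG by blast
    qed
    \<comment> \<open>\<open>C n\<close> is the closed set of points that are right up to block
      \<open>n\<close>. Their initial error lies in \<open>D\<close>, which confines them to the
      compact set \<open>K\<close>.\<close>
    define C where "C n = {z \<in> topspace T. \<forall>i\<le>n. y 0 z i \<in> D}" for n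
    define K where "K = (\<lambda>u. x 0 \<otimes> inv u) ` D"
    have cy: "continuous_map T T (\<lambda>z. y 0 z i)" for i
      unfolding y_def using x
      by (intro continuous_map_binary_mult continuous_map_binary_inv pow_continuous)
        (auto simp: topspace_eq)
    obtain z where z: "z \<in> K" "\<And>n. z \<in> C n"
    proof (rule compactin_nested_Inter[of T K C])
      have "continuous_map T T (\<lambda>u. x 0 \<otimes> inv u)"
        using x by (intro continuous_map_binary_mult continuous_inv) (auto simp: topspace_eq)
      then show "compactin T K" unfolding K_def using D(2) by (rule image_compactin[rotated])
      show "closedin T (C n)" for n
      proof -
        have "closedin T (\<Inter>i\<in>{..n}. {z \<in> topspace T. y 0 z i \<in> D})"
          using D(2) Hausdorff
          by (intro closedin_Inter) (auto intro!: closedin_continuous_map_preimage[OF cy] compactin_imp_closedin)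
        also have "(\<Inter>i\<in>{..n}. {z \<in> topspace T. y 0 z i \<in> D}) = C n" by (auto simp: C_def)
        finally show ?thesis .
      qed
      show "C (Suc n) \<subseteq> C n" for n by (auto simp: C_def)
      show "C n \<inter> K \<noteq> {}" for n
      proof -
        obtain z where z: "z \<in> carrier G" "\<forall>i\<le>n. y 0 z i \<in> D" using ex by blast
        have "x 0 \<otimes> inv (y 0 z 0) = z"
          using z(1) x by (simp add: y_def inv_mult_group m_assoc[symmetric])
        then have "z \<in> K" using z(2) unfolding K_def by (metis image_eqI le0)
        then show ?thesis using z by (auto simp: C_def topspace_eq)
      qed
    qed blast
    have zG: "z \<in> carrier G" using z(2)[of 0] by (simp add: C_def topspace_eq)
    have yD: "y 0 z i \<in> D" for i using z(2)[of i] by (simp add: C_def)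
    have "inv ((\<alpha> ^^ k) z) \<otimes> x k \<in> U0" for k
    proof -
      \<comment> \<open>Within a block the error is the image of the block error under
        \<open>\<alpha> ^^ j\<close> times the drift, and \<open>\<alpha> ^^ j\<close> maps
        \<open>U M\<close> into \<open>U (M - j)\<close>, hence into \<open>W\<close>.\<close>
      define i j where "i = k div M" and "j = k mod M"
      have k: "k = i * M + j" "j \<le> M" using M(2) by (auto simp: i_def j_def less_imp_le)
      have "(\<alpha> ^^ k) z = (\<alpha> ^^ j) ((\<alpha> ^^ (i * M)) z)"
        by (simp add: k add.commute[of "i * M"] funpow_add)
      then have "inv ((\<alpha> ^^ k) z) \<otimes> x k = (\<alpha> ^^ j) (y 0 z i) \<otimes> w (i * M) j"
        using w(1)[of "i * M" j] w(2)[of "i * M" j] x zG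
        by (simp add: k(1)[symmetric] y_def pow_mult pow_inv m_assoc)
      moreover have "(\<alpha> ^^ j) (y 0 z i) \<in> W"
      proof -
        have "y 0 z i \<in> U ((M - j) + j)" using yD k(2) by (simp add: D_def)
        then have "(\<alpha> ^^ j) (y 0 z i) \<in> U (M - j)" using im[of j "M - j"] by blast
        then show ?thesis using U(3) by blast
      qed
      moreover have "w (i * M) j \<in> W" using wR[OF k(2)] by (simp add: R_def)
      ultimately show ?thesis using W(2) by simp
    qed
    then show ?thesis using zG by (auto simp: shadowed_by_def)
  qed
  then show "\<exists>V. nbhd V \<and> (\<forall>x. pseudo_orbit G \<alpha> V x \<longrightarrow> (\<exists>z\<in>carrier G. shadowed_by G \<alpha> U0 x z))"
    using V(1) by (intro exI[of _ V]) simp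
qed

end

section \<open>Iterated commutators and nilpotency\<close>

context group
begin

definition commut :: "'a \<Rightarrow> 'a \<Rightarrow> 'a" where
  "commut x y = x \<otimes> y \<otimes> inv x \<otimes> inv y"

text \<open>Left-normed commutators of \<open>n + 1\<close> elements of \<open>S\<close>, without
  forming subgroups, so that each can be estimated in norm.\<close>

primrec iterated_commutators :: "'a set \<Rightarrow> nat \<Rightarrow> 'a set" where
  "iterated_commutators S 0 = S"
| "iterated_commutators S (Suc n) = {commut x s | x s. x \<in> iterated_commutators S n \<and> s \<in> S}"

text \<open>The successor step is the preimage of the centre of \<open>H\<close> modulo the previous
  term, written without a quotient group.\<close>

primrec upper_central :: "'a set \<Rightarrow> nat \<Rightarrow> 'a set" where
  "upper_central H 0 = {\<one>}"
| "upper_central H (Suc n) = {x \<in> H. \<forall>g\<in>H. commut x g \<in> upper_central H n}"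

lemma commut_closed [simp]: "x \<in> carrier G \<Longrightarrow> y \<in> carrier G \<Longrightarrow> commut x y \<in> carrier G"
  by (simp add: commut_def)

lemma iterated_commutators_closed:
  "S \<subseteq> carrier G \<Longrightarrow> iterated_commutators S n \<subseteq> carrier G"
  by (induction n) (auto intro!: commut_closed)

lemma inv_mult_cancel:
  assumes "x \<in> carrier G" "y \<in> carrier G"
  shows "inv x \<otimes> (x \<otimes> y) = y" "x \<otimes> (inv x \<otimes> y) = y"
  using assms by (simp_all add: m_assoc[symmetric])

text \<open>Brings a word into right-nested reduced form, so that identities valid in free groups
  are proved by comparing both sides.\<close>

lemmas free_group_simps = commut_def m_assoc inv_mult_group inv_mult_cancel

text \<open>With \<open>[x, g]\<close> for \<open>commut x g\<close>, this rests on
  \<open>[xy, g] = x [y, g] x^-1 [x, g]\<close>, \<open>[x^-1, g] = x^-1 [x, g]^-1 x\<close> and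
  \<open>[h x h^-1, g] = h [x, h^-1 g h] h^-1\<close>. Closure of a term uses normality of the
  previous one, so both are proved together.\<close>

lemma upper_central_normal:
  assumes H: "subgroup H G"
  shows "subgroup (upper_central H n) G \<and> upper_central H n \<subseteq> H \<and>
    (\<forall>x\<in>upper_central H n. \<forall>h\<in>H. h \<otimes> x \<otimes> inv h \<in> upper_central H n)"
proof (induction n)
  case 0
  then show ?case using H subgroup.mem_carrier[OF H] by (auto simp: subgroup.one_closed intro: triv_subgroup)
next
  case (Suc n)
  define N where "N = upper_central H n"
  have N: "subgroup N G" "N \<subseteq> H" "\<And>x h. x \<in> N \<Longrightarrow> h \<in> H \<Longrightarrow> h \<otimes> x \<otimes> inv h \<in> N"
    using Suc by (auto simp: N_def)
  note car = subgroup.mem_carrier[OF H]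
  note Hc = subgroup.m_closed[OF H] subgroup.m_inv_closed[OF H] subgroup.one_closed[OF H]
  note Nc = subgroup.m_closed[OF N(1)] subgroup.m_inv_closed[OF N(1)] subgroup.one_closed[OF N(1)]
  define N' where "N' = upper_central H (Suc n)"
  have N': "x \<in> N' \<longleftrightarrow> x \<in> H \<and> (\<forall>g\<in>H. commut x g \<in> N)" for x
    by (simp add: N'_def N_def)
  have "x \<otimes> y \<in> N'" if "x \<in> N'" "y \<in> N'" for x y
  proof -
    have "commut (x \<otimes> y) g \<in> N" if g: "g \<in> H" for g
    proof -
      have "commut (x \<otimes> y) g = (x \<otimes> commut y g \<otimes> inv x) \<otimes> commut x g"
        using \<open>x \<in> N'\<close> \<open>y \<in> N'\<close> g by (simp add: free_group_simps N' car)
      also have "\<dots> \<in> N" using \<open>x \<in> N'\<close> \<open>y \<in> N'\<close> g by (intro Nc N) (auto simp: N')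
      finally show ?thesis .
    qed
    then show ?thesis using that by (simp add: N' Hc)
  qed
  moreover have "inv x \<in> N'" if "x \<in> N'" for x
  proof -
    have "commut (inv x) g \<in> N" if g: "g \<in> H" for g
    proof -
      have "commut (inv x) g = inv x \<otimes> inv (commut x g) \<otimes> inv (inv x)"
        using \<open>x \<in> N'\<close> g by (simp add: free_group_simps N' car)
      also have "\<dots> \<in> N" using \<open>x \<in> N'\<close> g by (intro Nc N Hc) (auto simp: N')
      finally show ?thesis .
    qed
    then show ?thesis using that by (simp add: N' Hc)
  qed
  moreover have "\<one> \<in> N'" by (auto simp: N' Hc commut_def Nc car)
  ultimately have "subgroup N' G"
    by (intro subgroup.intro) (auto simp: N' car)
  moreover have "h \<otimes> x \<otimes> inv h \<in> N'" if "x \<in> N'" "h \<in> H" for x h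
  proof -
    have "commut (h \<otimes> x \<otimes> inv h) g \<in> N" if g: "g \<in> H" for g
    proof -
      have "commut (h \<otimes> x \<otimes> inv h) g = h \<otimes> commut x (inv h \<otimes> g \<otimes> h) \<otimes> inv h"
        using \<open>x \<in> N'\<close> \<open>h \<in> H\<close> g by (simp add: free_group_simps N' car)
      also have "\<dots> \<in> N" using \<open>x \<in> N'\<close> \<open>h \<in> H\<close> g Hc by (intro N) (auto simp: N')
      finally show ?thesis .
    qed
    then show ?thesis using that by (simp add: N' Hc)
  qed
  ultimately show ?case unfolding N'_def[symmetric] by (auto simp: N')
qed

text \<open>One more commutator with \<open>S\<close> lands one term lower by induction;
  \<open>[x, gh] = [x, g] g [x, h] g^-1\<close> and normality extend this from \<open>S\<close> to
  the generated group.\<close>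

lemma iterated_commutators_upper_central:
  assumes S: "S \<subseteq> carrier G" and triv: "iterated_commutators S (i + j) \<subseteq> {\<one>}"
  shows "iterated_commutators S j \<subseteq> upper_central (generate G S) i"
  using triv
proof (induction i arbitrary: j)
  case (Suc i)
  let ?H = "generate G S" and ?N = "upper_central (generate G S) i"
  have H: "subgroup ?H G" using S by (rule generate_is_subgroup)
  have N: "subgroup ?N G" "\<And>x h. x \<in> ?N \<Longrightarrow> h \<in> ?H \<Longrightarrow> h \<otimes> x \<otimes> inv h \<in> ?N"
    using upper_central_normal[OF H] by auto
  note Nc = subgroup.m_closed[OF N(1)] subgroup.m_inv_closed[OF N(1)] subgroup.one_closed[OF N(1)]
  note Hc = subgroup.m_inv_closed[OF H]
  have IH: "iterated_commutators S (Suc j) \<subseteq> ?N"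
    using Suc.IH[of "Suc j"] Suc.prems by (simp only: add_Suc_right add_Suc)
  have sub: "iterated_commutators S m \<subseteq> ?H" for m
  proof (induction m)
    case (Suc m)
    then show ?case
      using H generate.incl[of _ S G] unfolding commut_def
      by (auto simp: commut_def intro!: subgroup.m_closed subgroup.m_inv_closed)
  qed (auto intro: generate.incl)
  show ?case
  proof
    fix x assume x: "x \<in> iterated_commutators S j"
    then have xH: "x \<in> ?H" using sub by blast
    then have xG: "x \<in> carrier G" using subgroup.mem_carrier[OF H] by blast
    have car: "g \<in> ?H \<Longrightarrow> g \<in> carrier G" for g using subgroup.mem_carrier[OF H] .
    have s: "commut x s \<in> ?N" if "s \<in> S" for s using IH x that by auto
    have "commut x g \<in> ?N" if "g \<in> ?H" for g
      using that
    proof (induction rule: generate.induct)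
      case one
      then show ?case using xG by (simp add: commut_def Nc)
    next
      case (incl h)
      then show ?case by (rule s)
    next
      case (inv h)
      have h: "h \<in> ?H" "h \<in> carrier G" using inv S by (auto intro: generate.incl)
      have "commut x (inv h) = inv h \<otimes> inv (commut x h) \<otimes> inv (inv h)"
        using xG h by (simp add: free_group_simps)
      also have "\<dots> \<in> ?N" using h s[OF inv] by (intro Nc N Hc)
      finally show ?case .
    next
      case (eng g h)
      have gh: "g \<in> carrier G" "h \<in> carrier G" using eng car by auto
      have "commut x (g \<otimes> h) = commut x g \<otimes> (g \<otimes> commut x h \<otimes> inv g)"
        using xG gh by (simp add: free_group_simps)
      also have "\<dots> \<in> ?N" using eng by (intro Nc N)
      finally show ?case .
    qed
    then show "x \<in> upper_central ?H (Suc i)" using xH by simp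
  qed
qed simp

text \<open>The case \<open>j = 0\<close> above puts \<open>S\<close>, hence the generated group,
  into the \<open>k\<close>-th upper central term. The lower central series of \<open>C\<close> then
  descends through these terms.\<close>

lemma nilpotent_subgroup_of_generate:
  assumes S: "S \<subseteq> carrier G" and triv: "iterated_commutators S k \<subseteq> {\<one>}"
    and C: "subgroup C G" "C \<subseteq> generate G S"
  shows "nilpotent_group (G\<lparr>carrier := C\<rparr>)"
proof -
  let ?K = "G\<lparr>carrier := C\<rparr>" and ?H = "generate G S"
  have K: "group ?K" using C(1) by (simp add: subgroup_imp_group)
  have H: "subgroup ?H G" using S by (rule generate_is_subgroup)
  have ucs: "subgroup (upper_central ?H n) G" for n using upper_central_normal[OF H] by blast
  have inv: "inv\<^bsub>?K\<^esub> x = inv x" if "x \<in> C" for x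
    using m_inv_consistent[OF C(1) that] .
  have gen: "generate ?K A \<subseteq> C \<inter> N" if A: "A \<subseteq> C" "A \<subseteq> N" "subgroup N G" for A N
  proof
    fix x assume "x \<in> generate ?K A"
    then show "x \<in> C \<inter> N"
    proof (induction rule: generate.induct)
      case one
      then show ?case using subgroup.one_closed C(1) A(3) by auto
    next
      case (inv h)
      then have "inv\<^bsub>?K\<^esub> h = inv h" using A m_inv_consistent[OF C(1)] by blast
      then show ?case using inv A subgroup.m_inv_closed[OF C(1)] subgroup.m_inv_closed[OF A(3)] by auto
    next
      case (eng g h)
      then show ?case using subgroup.m_closed[OF C(1)] subgroup.m_closed[OF A(3)] by auto
    qed (use A in auto)
  qed
  have "iterated_commutators S 0 \<subseteq> upper_central ?H k"
    using S triv by (intro iterated_commutators_upper_central) auto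
  then have top: "?H \<subseteq> upper_central ?H k" using ucs generate_subgroup_incl by simp
  have "lower_central ?K i \<subseteq> C \<inter> upper_central ?H (k - i)" if "i \<le> k" for i
    using that
  proof (induction i)
    case 0
    then show ?case using C(2) top by auto
  next
    case (Suc i)
    define A where "A = {x \<otimes>\<^bsub>?K\<^esub> y \<otimes>\<^bsub>?K\<^esub> inv\<^bsub>?K\<^esub> x \<otimes>\<^bsub>?K\<^esub> inv\<^bsub>?K\<^esub> y | x y. x \<in> lower_central ?K i \<and> y \<in> carrier ?K}"
    have IH: "lower_central ?K i \<subseteq> C \<inter> upper_central ?H (Suc (k - Suc i))"
      using Suc by (simp add: Suc_diff_Suc)
    have "a \<in> C \<inter> upper_central ?H (k - Suc i)" if "a \<in> A" for a
    proof -
      obtain x y where xy: "x \<in> lower_central ?K i" "y \<in> C"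
        and a: "a = x \<otimes> y \<otimes> inv\<^bsub>?K\<^esub> x \<otimes> inv\<^bsub>?K\<^esub> y"
        using \<open>a \<in> A\<close> by (auto simp: A_def)
      have x: "x \<in> C" "x \<in> upper_central ?H (Suc (k - Suc i))" using IH xy by auto
      have "a = commut x y" using a inv x xy by (simp add: commut_def)
      moreover have "commut x y \<in> C"
        unfolding commut_def using x xy C(1) by (intro subgroup.m_closed subgroup.m_inv_closed)
      moreover have "commut x y \<in> upper_central ?H (k - Suc i)" using x xy C(2) by auto
      ultimately show ?thesis by simp
    qed
    then have "generate ?K A \<subseteq> C \<inter> upper_central ?H (k - Suc i)"
      by (intro gen ucs) auto
    then show ?case by (simp add: A_def)
  qed
  from this[of k] have "lower_central ?K k \<subseteq> {\<one>}" by auto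
  moreover have "\<one> \<in> lower_central ?K k"
    using subgroup.one_closed[OF C(1)] generate.one[of ?K] by (cases k) auto
  ultimately have "lower_central ?K k = {\<one>\<^bsub>?K\<^esub>}" by auto
  then show ?thesis using K by (auto simp: nilpotent_group_def)
qed

end

section \<open>The identity component\<close>

context topological_group
begin

lemma continuous_left_translation: "g \<in> carrier G \<Longrightarrow> continuous_map T T (\<lambda>x. g \<otimes> x)"
  by (intro continuous_map_binary_mult) (auto simp: topspace_eq)

text \<open>Translating the component by the inverse of one of its points gives a connected set
  through \<open>\<one>\<close>, hence a subset of the component; so it is closed under
  quotients.\<close>

lemma identity_component_subgroup: "subgroup (identity_component G T) G"
proof -
  let ?C = "identity_component G T"
  have con: "connectedin T ?C"
    unfolding identity_component_def by (rule connectedin_connected_component_of)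
  have sub: "?C \<subseteq> carrier G"
    unfolding identity_component_def using connected_component_of_subset_topspace topspace_eq by metis
  have one: "\<one> \<in> ?C"
    unfolding identity_component_def by (simp add: connected_component_of_refl topspace_eq)
  have quot: "inv x \<otimes> y \<in> ?C" if "x \<in> ?C" "y \<in> ?C" for x y
  proof -
    have "x \<in> carrier G" using that sub by blast
    then have "connectedin T ((\<lambda>y. inv x \<otimes> y) ` ?C)"
      by (intro connectedin_continuous_map_image[OF continuous_left_translation con]) simp
    moreover have "\<one> \<in> (\<lambda>y. inv x \<otimes> y) ` ?C"
      using that \<open>x \<in> carrier G\<close> by (auto intro!: image_eqI[of _ _ x])
    ultimately have "(\<lambda>y. inv x \<otimes> y) ` ?C \<subseteq> ?C"
      unfolding identity_component_def by (rule connected_component_of_maximal)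
    then show ?thesis using that by blast
  qed
  have inv: "inv x \<in> ?C" if "x \<in> ?C" for x
    using quot[OF that one] that sub by auto
  show ?thesis
  proof (rule subgroupI)
    show "x \<otimes> y \<in> ?C" if "x \<in> ?C" "y \<in> ?C" for x y
      using quot[OF inv[OF that(1)] that(2)] that sub by auto
  qed (use sub one inv in auto)
qed

text \<open>The generated subgroup contains a translate of an open \<open>W\<close> around each of
  its points, and the translates around other points miss it. So it is open and closed, and a
  connected set through \<open>\<one>\<close> cannot leave it.\<close>

lemma identity_component_subset_generate:
  assumes D: "nbhd D"
  shows "identity_component G T \<subseteq> generate G D"
proof -
  let ?H = "generate G D"
  have H: "subgroup ?H G" using nbhd_subset[OF D] by (rule generate_is_subgroup)
  note car = subgroup.mem_carrier[OF H]
  obtain W where W: "openin T W" "\<one> \<in> W" "W \<subseteq> D" using D by (auto simp: neighbourhood_of_def)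
  have WH: "W \<subseteq> ?H" using W(3) by (auto intro: generate.incl)
  define V where "V x = {y \<in> topspace T. inv x \<otimes> y \<in> W}" for x
  have V: "openin T (V x)" "x \<in> V x" if "x \<in> carrier G" for x
    using that W openin_continuous_map_preimage[OF continuous_left_translation, of "inv x" W]
    by (simp_all add: V_def topspace_eq)
  have mem: "x \<in> ?H \<longleftrightarrow> y \<in> ?H" if "x \<in> carrier G" "y \<in> V x" for x y
  proof -
    have y: "y \<in> carrier G" "inv x \<otimes> y \<in> ?H" using that WH by (auto simp: V_def topspace_eq)
    have "x \<otimes> (inv x \<otimes> y) = y" "y \<otimes> inv (inv x \<otimes> y) = x"
      using that(1) y(1) by (simp_all add: inv_mult_group m_assoc[symmetric])
    then show ?thesis using y(2) H by (metis subgroup.m_closed subgroup.m_inv_closed)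
  qed
  have op: "openin T ?H"
  proof (subst openin_subopen, intro ballI)
    fix x assume x: "x \<in> ?H"
    then have "V x \<subseteq> ?H" using mem[OF car[OF x]] by blast
    then show "\<exists>U. openin T U \<and> x \<in> U \<and> U \<subseteq> ?H"
      using V[OF car[OF x]] by (intro exI[of _ "V x"]) simp
  qed
  have "openin T (topspace T - ?H)"
  proof (subst openin_subopen, intro ballI)
    fix x assume "x \<in> topspace T - ?H"
    then show "\<exists>U. openin T U \<and> x \<in> U \<and> U \<subseteq> topspace T - ?H"
      using V[of x] mem[of x] by (intro exI[of _ "V x"]) (auto simp: topspace_eq V_def)
  qed
  then have cl: "closedin T ?H" using car by (auto simp: closedin_def topspace_eq)
  have con: "connectedin T (identity_component G T)"
    unfolding identity_component_def by (rule connectedin_connected_component_of)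
  have "identity_component G T \<subseteq> ?H \<or> disjnt (identity_component G T) ?H"
    by (rule connectedin_clopen_cases[OF con cl op])
  moreover have "\<one> \<in> identity_component G T" "\<one> \<in> ?H"
    using subgroup.one_closed identity_component_subgroup H by auto
  ultimately show ?thesis by (auto simp: disjnt_def)
qed

end

section \<open>Commutators in local coordinates\<close>

text \<open>An interface between charts and group theory: coordinates centred at \<open>0\<close>
  with one second-order and one first-order estimate for the product. By the bound on
  \<open>C * r\<close>, a further factor \<open>x\<close> moves the coordinate by
  \<open>\<phi> x\<close> up to half its norm.\<close>

locale local_coordinates = topological_group +
  fixes \<phi> :: "'a \<Rightarrow> 'e::real_normed_vector" and D :: "'a set" and r C :: real
  assumes domain: "D \<subseteq> carrier G"
    and coord_one: "\<one> \<in> D" "\<phi> \<one> = 0"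
    and coord_inj: "\<And>x. x \<in> D \<Longrightarrow> \<phi> x = 0 \<Longrightarrow> x = \<one>"
    and nbhd_coord_ball: "\<And>\<rho>. \<rho> > 0 \<Longrightarrow> nbhd {x \<in> D. norm (\<phi> x) \<le> \<rho>}"
    and coord_ball_small: "\<And>W. nbhd W \<Longrightarrow> \<exists>\<rho>>0. {x \<in> D. norm (\<phi> x) \<le> \<rho>} \<subseteq> W"
    and radius: "r > 0" "C \<ge> 0" "C * r \<le> 1 / 2"
    and mult_domain: "\<And>x y. \<lbrakk>x \<in> D; norm (\<phi> x) \<le> r; y \<in> D; norm (\<phi> y) \<le> r\<rbrakk> \<Longrightarrow> x \<otimes> y \<in> D"
    and mult_approx: "\<And>x y. \<lbrakk>x \<in> D; norm (\<phi> x) \<le> r; y \<in> D; norm (\<phi> y) \<le> r\<rbrakk> \<Longrightarrow>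
      norm (\<phi> (x \<otimes> y) - \<phi> x - \<phi> y) \<le> C * norm (\<phi> x) * norm (\<phi> y)"
    and mult_Lipschitz: "\<And>x y z. \<lbrakk>x \<in> D; norm (\<phi> x) \<le> r; y \<in> D; norm (\<phi> y) \<le> r; z \<in> D; norm (\<phi> z) \<le> r\<rbrakk> \<Longrightarrow>
      norm (\<phi> (x \<otimes> z) - \<phi> (y \<otimes> z)) \<le> C * norm (\<phi> x - \<phi> y)"
begin

definition B :: "real \<Rightarrow> 'a set" where "B \<rho> = {x \<in> D. norm (\<phi> x) \<le> \<rho>}"

lemma B_D: "x \<in> B \<rho> \<Longrightarrow> x \<in> D" and B_norm: "x \<in> B \<rho> \<Longrightarrow> norm (\<phi> x) \<le> \<rho>"
  by (auto simp: B_def)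

lemma B_mono: "\<rho> \<le> \<sigma> \<Longrightarrow> B \<rho> \<subseteq> B \<sigma>"
  by (auto simp: B_def)

lemma nbhd_B: "\<rho> > 0 \<Longrightarrow> nbhd (B \<rho>)"
  unfolding B_def by (rule nbhd_coord_ball)

lemma B_small: assumes "nbhd W" obtains \<rho> where "\<rho> > 0" "B \<rho> \<subseteq> W"
  using coord_ball_small[OF assms] unfolding B_def by blast

lemma B_carrier: "x \<in> B \<rho> \<Longrightarrow> x \<in> carrier G"
  using domain by (auto simp: B_def)

lemma mult_B:
  assumes "x \<in> B r" "y \<in> B r"
  shows "x \<otimes> y \<in> D" "norm (\<phi> (x \<otimes> y) - \<phi> x - \<phi> y) \<le> C * norm (\<phi> x) * norm (\<phi> y)"
  using assms by (auto simp: B_def intro: mult_domain mult_approx)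

text \<open>Powers that stay in the coordinate ball grow linearly, since each step of
  \<open>x [^] i\<close> differs from \<open>\<phi> x\<close> by at most \<open>C r \<le> 1/2\<close> times \<open>norm (\<phi> x)\<close>.\<close>

lemma norm_le_of_pow_bounded:
  assumes "\<And>i. i \<le> j \<Longrightarrow> x [^] i \<in> B r" and x: "x \<in> B r"
  shows "real j * norm (\<phi> x) \<le> 2 * r"
proof -
  have "norm (\<phi> (x [^] i) - real i *\<^sub>R \<phi> x) \<le> real i / 2 * norm (\<phi> x)" if "i \<le> j" for i
    using that
  proof (induction i)
    case (Suc i)
    have xi: "x [^] i \<in> B r" using assms(1) Suc by simp
    have "norm (\<phi> (x [^] i \<otimes> x) - \<phi> (x [^] i) - \<phi> x) \<le> C * norm (\<phi> (x [^] i)) * norm (\<phi> x)"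
      by (rule mult_B(2)[OF xi x])
    also have "\<dots> \<le> C * r * norm (\<phi> x)"
      using B_norm[OF xi] radius by (intro mult_right_mono mult_left_mono) auto
    also have "\<dots> \<le> 1 / 2 * norm (\<phi> x)" using radius by (intro mult_right_mono) auto
    finally have 1: "norm (\<phi> (x [^] Suc i) - \<phi> (x [^] i) - \<phi> x) \<le> 1 / 2 * norm (\<phi> x)" by simp
    have "norm (\<phi> (x [^] Suc i) - real (Suc i) *\<^sub>R \<phi> x)
        \<le> norm (\<phi> (x [^] Suc i) - \<phi> (x [^] i) - \<phi> x) + norm (\<phi> (x [^] i) - real i *\<^sub>R \<phi> x)"
      by (rule order_trans[OF _ norm_triangle_ineq]) (simp add: algebra_simps)
    then show ?case using 1 Suc by (simp add: algebra_simps)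
  qed (simp add: coord_one)
  from this[of j] have "norm (real j *\<^sub>R \<phi> x) \<le> real j / 2 * norm (\<phi> x) + norm (\<phi> (x [^] j))"
    using norm_triangle_ineq2[of "real j *\<^sub>R \<phi> x" "\<phi> (x [^] j)"] by (simp add: norm_minus_commute)
  then show ?thesis using B_norm[OF assms(1)[of j]] by simp
qed

text \<open>Opposite to \<open>norm_le_of_pow_bounded\<close>: a further factor adds at most
  \<open>3 / 2 * norm (\<phi> x)\<close>, rounded up to \<open>2 * norm (\<phi> x)\<close>, and the
  bound itself keeps the powers in \<open>B r\<close>, where this estimate holds.\<close>

lemma pow_in_B:
  assumes x: "x \<in> B r" and \<rho>: "\<rho> \<le> r" "2 * real j * norm (\<phi> x) \<le> \<rho>" and "i \<le> j"
  shows "x [^] i \<in> B \<rho>"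
proof -
  have "x [^] i \<in> D \<and> norm (\<phi> (x [^] i)) \<le> 2 * real i * norm (\<phi> x)" using \<open>i \<le> j\<close>
  proof (induction i)
    case (Suc i)
    have "2 * real i * norm (\<phi> x) \<le> 2 * real j * norm (\<phi> x)"
      using Suc.prems by (intro mult_right_mono) auto
    then have xi: "x [^] i \<in> B r" using Suc \<rho> by (auto simp: B_def)
    have "norm (\<phi> (x [^] i \<otimes> x) - \<phi> (x [^] i) - \<phi> x) \<le> C * norm (\<phi> (x [^] i)) * norm (\<phi> x)"
      by (rule mult_B(2)[OF xi x])
    also have "\<dots> \<le> C * r * norm (\<phi> x)"
      using B_norm[OF xi] radius by (intro mult_right_mono mult_left_mono) auto
    also have "\<dots> \<le> 1 / 2 * norm (\<phi> x)" using radius by (intro mult_right_mono) auto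
    finally have 1: "norm (\<phi> (x [^] i \<otimes> x) - \<phi> (x [^] i) - \<phi> x) \<le> 1 / 2 * norm (\<phi> x)" .
    have "norm (\<phi> (x [^] i \<otimes> x)) \<le> norm (\<phi> (x [^] i \<otimes> x) - \<phi> (x [^] i) - \<phi> x) + norm (\<phi> (x [^] i) + \<phi> x)"
      by (rule order_trans[OF _ norm_triangle_ineq]) (simp add: algebra_simps)
    also have "norm (\<phi> (x [^] i) + \<phi> x) \<le> norm (\<phi> (x [^] i)) + norm (\<phi> x)"
      by (rule norm_triangle_ineq)
    finally have 2: "norm (\<phi> (x [^] i \<otimes> x)) \<le> norm (\<phi> (x [^] i \<otimes> x) - \<phi> (x [^] i) - \<phi> x)
        + (norm (\<phi> (x [^] i)) + norm (\<phi> x))" by simp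
    have "norm (\<phi> (x [^] i)) \<le> 2 * real i * norm (\<phi> x)" using Suc by simp
    moreover have "2 * real (Suc i) * norm (\<phi> x) = 2 * real i * norm (\<phi> x) + 2 * norm (\<phi> x)"
      by (simp add: algebra_simps)
    ultimately have "norm (\<phi> (x [^] i \<otimes> x)) \<le> 2 * real (Suc i) * norm (\<phi> x)"
      using 1 2 norm_ge_zero[of "\<phi> x"] by linarith
    then show ?case using mult_B(1)[OF xi x] by simp
  qed (simp add: coord_one)
  moreover have "2 * real i * norm (\<phi> x) \<le> 2 * real j * norm (\<phi> x)"
    using \<open>i \<le> j\<close> by (intro mult_right_mono) auto
  ultimately show ?thesis using \<rho> by (auto simp: B_def)
qed

text \<open>With \<open>p = x \<otimes> y\<close> and \<open>q = y \<otimes> x\<close>, the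
  commutator is \<open>p \<otimes> inv q\<close> and \<open>\<one>\<close> is
  \<open>q \<otimes> inv q\<close>. Right multiplication is Lipschitz, and \<open>\<phi> p\<close>
  and \<open>\<phi> q\<close> both differ from \<open>\<phi> x + \<phi> y\<close> by a quadratic
  term.\<close>

lemma commut_bound:
  obtains \<delta> K where "\<delta> > 0" "K \<ge> 1" "\<And>x y. x \<in> B \<delta> \<Longrightarrow> y \<in> B \<delta> \<Longrightarrow>
      commut x y \<in> D \<and> norm (\<phi> (commut x y)) \<le> K * norm (\<phi> x) * norm (\<phi> y)"
proof -
  obtain V where V: "nbhd V" "\<And>x y. x \<in> V \<Longrightarrow> y \<in> V \<Longrightarrow> x \<otimes> y \<in> B r \<inter> {x \<in> carrier G. inv x \<in> B r}"
    by (rule nbhd_mult[OF nbhd_Int[OF nbhd_B[OF radius(1)] nbhd_inv[OF nbhd_B[OF radius(1)]]]]) blast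
  obtain \<delta>0 where \<delta>0: "\<delta>0 > 0" "B \<delta>0 \<subseteq> V" using B_small[OF V(1)] .
  define \<delta> where "\<delta> = min \<delta>0 r"
  define K where "K = max 1 (C * (2 * C))"
  have "commut x y \<in> D \<and> norm (\<phi> (commut x y)) \<le> K * norm (\<phi> x) * norm (\<phi> y)"
    if x: "x \<in> B \<delta>" and y: "y \<in> B \<delta>" for x y
  proof -
    have xV: "x \<in> V" and yV: "y \<in> V" and xr: "x \<in> B r" and yr: "y \<in> B r"
      using x y B_mono[of \<delta> \<delta>0] B_mono[of \<delta> r] \<delta>0 by (auto simp: \<delta>_def)
    have car: "x \<in> carrier G" "y \<in> carrier G" using x y B_carrier by auto
    define p q where "p = x \<otimes> y" and "q = y \<otimes> x"
    have p: "p \<in> B r" and q: "q \<in> B r" "inv q \<in> B r"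
      using V(2)[OF xV yV] V(2)[OF yV xV] by (auto simp: p_def q_def)
    have c: "commut x y = p \<otimes> inv q"
      using car by (simp add: commut_def p_def q_def m_assoc inv_mult_group)
    have "q \<otimes> inv q = \<one>" using B_carrier[OF q(1)] by simp
    then have "norm (\<phi> (commut x y)) = norm (\<phi> (p \<otimes> inv q) - \<phi> (q \<otimes> inv q))"
      by (simp add: c coord_one)
    also have "\<dots> \<le> C * norm (\<phi> p - \<phi> q)"
      using p q by (intro mult_Lipschitz) (auto simp: B_def)
    also have "norm (\<phi> p - \<phi> q) \<le> norm (\<phi> p - \<phi> x - \<phi> y) + norm (\<phi> q - \<phi> y - \<phi> x)"
      by (rule order_trans[OF _ norm_triangle_ineq4]) (simp add: algebra_simps)
    also have "\<dots> \<le> 2 * C * norm (\<phi> x) * norm (\<phi> y)"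
      using mult_B(2)[OF xr yr] mult_B(2)[OF yr xr] by (simp add: p_def q_def algebra_simps)
    finally have "norm (\<phi> (commut x y)) \<le> C * (2 * C) * (norm (\<phi> x) * norm (\<phi> y))"
      using radius(2) by (simp add: mult_left_mono mult.assoc)
    also have "\<dots> \<le> K * (norm (\<phi> x) * norm (\<phi> y))"
      by (intro mult_right_mono) (auto simp: K_def)
    finally show ?thesis using mult_B(1)[OF p q(2)] c by (simp add: mult.assoc)
  qed
  then show ?thesis using that[of \<delta> K] \<delta>0 radius(1) by (simp add: \<delta>_def K_def)
qed

text \<open>A continuous endomorphism is Lipschitz at \<open>\<one>\<close>: if the first \<open>j\<close> powers of \<open>x\<close> lie in a
  small ball, then those of the image lie in \<open>B r\<close>, and \<open>j\<close> can be chosen of order \<open>1 / norm (\<phi> x)\<close>.\<close>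

lemma endo_Lipschitz_at_one:
  assumes g: "g \<in> hom G G" "continuous_map T T g"
  obtains \<rho> L where "\<rho> > 0" "L \<ge> 1" "\<And>x. x \<in> B \<rho> \<Longrightarrow> g x \<in> D \<and> norm (\<phi> (g x)) \<le> L * norm (\<phi> x)"
proof -
  interpret g: group_hom G G g by (simp add: group_hom_def group_hom_axioms_def is_group g)
  obtain \<rho>0 where \<rho>0: "\<rho>0 > 0" "B \<rho>0 \<subseteq> {x \<in> carrier G. g x \<in> B r}"
    using B_small[OF nbhd_preimage[OF g(2) g.hom_one nbhd_B[OF radius(1)]]] .
  define \<rho>1 where "\<rho>1 = min \<rho>0 r"
  have \<rho>1: "\<rho>1 > 0" "\<rho>1 \<le> r" "B \<rho>1 \<subseteq> B \<rho>0"
    using \<rho>0 radius B_mono by (auto simp: \<rho>1_def)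
  define L where "L = max 1 (8 * r / \<rho>1)"
  have "g x \<in> D \<and> norm (\<phi> (g x)) \<le> L * norm (\<phi> x)" if x: "x \<in> B (\<rho>1 / 2)" for x
  proof (cases "\<phi> x = 0")
    case True
    then have "x = \<one>" using B_D[OF x] by (rule coord_inj[rotated])
    then show ?thesis using coord_one by simp
  next
    case False
    then have n: "norm (\<phi> x) > 0" by simp
    have xr: "x \<in> B r" using x B_mono[of "\<rho>1 / 2" r] \<rho>1 by auto
    have xG: "x \<in> carrier G" using x B_carrier by auto
    \<comment> \<open>By \<open>pow_in_B\<close> the powers of \<open>x\<close> up to
      \<open>t\<close> stay in \<open>B \<rho>1\<close>. Since
      \<open>norm (\<phi> x) \<le> \<rho>1 / 2\<close>, \<open>t\<close> is at least
      \<open>1\<close> and rounding down loses at most a factor 2.\<close>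
    define t where "t = \<rho>1 / (2 * norm (\<phi> x))"
    have t: "t \<ge> 1" using B_norm[OF x] n by (simp add: t_def field_simps)
    define j where "j = nat \<lfloor>t\<rfloor>"
    have fl: "1 \<le> \<lfloor>t\<rfloor>" using t by simp
    then have j: "real j = of_int \<lfloor>t\<rfloor>" by (simp add: j_def)
    with fl have "j \<ge> 1" by linarith
    with j have j: "real j \<le> t" "t / 2 \<le> real j" "j \<ge> 1" using t floor_correct[of t] by linarith+
    have "2 * real j * norm (\<phi> x) \<le> \<rho>1" using j(1) n by (simp add: t_def field_simps)
    then have "x [^] i \<in> B \<rho>1" if "i \<le> j" for i
      using pow_in_B[OF xr \<rho>1(2) _ that] by blast
    then have pw: "g x [^] i \<in> B r" if "i \<le> j" for i
      using that \<rho>1(3) \<rho>0(2) g.hom_nat_pow[OF xG, of i] by fastforce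
    have gx: "g x \<in> B r" using pw[of 1] j(3) xG by simp
    have "real j * norm (\<phi> (g x)) \<le> 2 * r" by (rule norm_le_of_pow_bounded[OF pw gx])
    then have "t / 2 * norm (\<phi> (g x)) \<le> 2 * r"
      using j(2) by (meson mult_right_mono norm_ge_zero order_trans)
    then have "norm (\<phi> (g x)) \<le> 8 * r / \<rho>1 * norm (\<phi> x)"
      using \<rho>1(1) n by (simp add: t_def field_simps)
    also have "\<dots> \<le> L * norm (\<phi> x)" by (intro mult_right_mono) (auto simp: L_def)
    finally show ?thesis using gx B_D by simp
  qed
  then show ?thesis using that[of "\<rho>1 / 2" L] \<rho>1 by (simp add: L_def)
qed

section \<open>Vanishing of long commutators\<close>

lemma hom_iterated_commutators:
  assumes h: "h \<in> hom G G" and S: "S' \<subseteq> carrier G" "S \<subseteq> h ` S'"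
    and c: "c \<in> iterated_commutators S k"
  obtains c' where "c' \<in> iterated_commutators S' k" "h c' = c"
proof -
  interpret h: group_hom G G h by (simp add: group_hom_def group_hom_axioms_def is_group h)
  have "\<exists>c'\<in>iterated_commutators S' k. h c' = c"
    using c
  proof (induction k arbitrary: c)
    case (Suc k)
    then obtain a s where a: "a \<in> iterated_commutators S k" "s \<in> S" "c = commut a s" by auto
    obtain a' where a': "a' \<in> iterated_commutators S' k" "h a' = a" using Suc.IH[OF a(1)] by blast
    obtain s' where s': "s' \<in> S'" "h s' = s" using a(2) S(2) by blast
    have "a' \<in> carrier G" "s' \<in> carrier G" 
      using a' s' S(1) iterated_commutators_closed[OF S(1), of k] by blast+
    then have "h (commut a' s') = c" using a' s' a by (simp add: commut_def)
    then show ?case using a' s' by auto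
  qed (use S(2) in auto)
  then show ?thesis using that by blast
qed

text \<open>Fix \<open>g = \<alpha> ^^ M\<close> such that every \<open>s\<close> in a neighbourhood \<open>U 0\<close> is \<open>(g ^^ n) s'\<close> with
  \<open>norm (\<phi> s') \<le> 2 r / 2 ^ n\<close>, and let \<open>L\<close> be a Lipschitz constant of \<open>g\<close> at \<open>\<one>\<close>. A \<open>k\<close>-fold
  commutator of such \<open>s'\<close> has size \<open>O (2 powr (- n (k + 1)))\<close>, so its image under \<open>g ^^ n\<close>, the
  commutator of the \<open>s\<close>, has size \<open>O ((L / 2 ^ (k + 1)) ^ n)\<close>. This tends to \<open>0\<close> once
  \<open>L < 2 ^ (k + 1)\<close>.\<close>

theorem commutators_trivial_of_expansive:
  assumes endo: "\<alpha> \<in> hom G G" "continuous_map T T \<alpha>"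
    and exp: "positively_expansive G T \<alpha>"
    and lc: "\<And>W. nbhd W \<Longrightarrow> \<exists>K. nbhd K \<and> compactin T K \<and> K \<subseteq> W"
    and op: "\<And>W. nbhd W \<Longrightarrow> nbhd (\<alpha> ` W)"
  shows "\<exists>S k. nbhd S \<and> iterated_commutators S k \<subseteq> {\<one>}"
proof -
  interpret topological_group_endo G T \<alpha> by unfold_locales (use endo in auto)
  obtain U where U: "\<And>n. nbhd (U n)" "\<And>n. compactin T (U n)" "\<And>n. U n \<subseteq> B r"
    "\<And>n. U (Suc n) \<subseteq> U n" "\<And>V. nbhd V \<Longrightarrow> \<exists>n. U n \<subseteq> V" "\<And>n. \<alpha> ` U (Suc n) = U n"
    "\<And>a b c M. \<lbrakk>a \<in> U M; b \<in> U M; c \<in> U M; (\<alpha> ^^ M) (a \<otimes> b) = (\<alpha> ^^ M) c\<rbrakk> \<Longrightarrow> a \<otimes> b = c"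
    by (rule expanding_filtration[OF exp _ _ nbhd_B[OF radius(1)]], erule lc, erule op) (rule that; assumption)
  note im = image_pow_filtration[of U, OF U(6)]
  obtain Y where Y: "nbhd Y" "\<And>x y. x \<in> Y \<Longrightarrow> y \<in> Y \<Longrightarrow> x \<otimes> y \<in> U 0"
    by (rule nbhd_mult[OF U(1)]) blast
  obtain M where M: "U M \<subseteq> Y" using U(5)[OF Y(1)] by blast
  define g where "g = \<alpha> ^^ M"
  have g: "g \<in> hom G G" "continuous_map T T g" by (simp_all add: g_def pow_hom pow_continuous)
  interpret g: topological_group_endo G T g by unfold_locales (use g in auto)
  have gU: "g ` U M = U 0" using im[of M 0] by (simp add: g_def)
  have UG: "x \<in> carrier G" if "x \<in> U n" for x n using that U(1) nbhd_subset by blast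
  \<comment> \<open>Counting powers in \<open>U 0\<close> measures size:
    \<open>norm_le_of_pow_bounded\<close> turns membership in \<open>E j\<close> into a norm bound
    of order \<open>1 / j\<close>.\<close>
  define E where "E j = {x \<in> carrier G. \<forall>i\<le>j. x [^] i \<in> U 0}" for j :: nat
  \<comment> \<open>Taking a preimage under \<open>g\<close> doubles the count. For
    \<open>i \<le> j\<close>, \<open>x [^] i\<close> lies in \<open>U M\<close>, because by the
    cancellation clause of the filtration it agrees with the preimage there of
    \<open>g x [^] i\<close>; powers up to \<open>2 * j\<close> are products of two of
    these.\<close>
  have E_double: "x \<in> E (2 * j)" if x: "x \<in> U M" and gx: "g x \<in> E j" for x j
  proof -
    have xG: "x \<in> carrier G" using x UG by blast
    have pw: "x [^] i \<in> U M" if "i \<le> j" for i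
      using that
    proof (induction i)
      case 0
      then show ?case using nbhd_one[OF U(1)] by simp
    next
      case (Suc i)
      have "g (x [^] i \<otimes> x) = g x [^] Suc i"
        using xG group_hom.hom_nat_pow[OF g.pow_group_hom[of 1], of x "Suc i"] by simp
      also have "\<dots> \<in> g ` U M" using gx Suc.prems gU by (auto simp: E_def)
      finally obtain c where "c \<in> U M" "g (x [^] i \<otimes> x) = g c" by auto
      then show ?case using U(7)[of "x [^] i" M x c] Suc x by (simp add: g_def)
    qed
    have "x [^] i \<in> U 0" if "i \<le> 2 * j" for i
    proof -
      have "x [^] i = x [^] (i div 2) \<otimes> x [^] (i - i div 2)"
        using xG by (simp add: nat_pow_mult)
      also have "\<dots> \<in> U 0" using that by (intro Y(2) subsetD[OF M] pw) auto
      finally show ?thesis .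
    qed
    then show ?thesis using xG by (simp add: E_def)
  qed
  \<comment> \<open>Starting from \<open>E 1\<close>, each of the \<open>n\<close> successive
    preimages doubles the count. This is the contraction by the factor 2.\<close>
  have pre: "\<exists>s'\<in>E (2 ^ n). (g ^^ n) s' = s" if s: "s \<in> U 0" for n s
  proof (induction n)
    case 0
    have "s [^] i \<in> U 0" if "i \<le> 1" for i :: nat
      using that s nbhd_one[OF U(1)] UG[OF s] by (cases i) auto
    then show ?case using UG[OF s] by (auto simp: E_def)
  next
    case (Suc n)
    then obtain s' where s': "s' \<in> E (2 ^ n)" "(g ^^ n) s' = s" by blast
    have "s' \<in> carrier G" "\<forall>i\<le>2 ^ n. s' [^] (i::nat) \<in> U 0" using s'(1) by (auto simp: E_def)
    then have "s' \<in> U 0" by (metis nat_pow_eone one_le_numeral one_le_power)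
    then have "s' \<in> g ` U M" using s'(1) gU by (simp add: E_def)
    then obtain x where x: "x \<in> U M" "s' = g x" by blast
    then have "x \<in> E (2 ^ Suc n)" using E_double[of x "2 ^ n"] s'(1) by simp
    moreover have "(g ^^ Suc n) x = s" using x s' by (simp add: funpow_swap1)
    ultimately show ?case by blast
  qed
  have E_small: "s \<in> B (2 * r / 2 ^ n)" if "s \<in> E (2 ^ n)" for n s
  proof -
    have pw: "s [^] i \<in> B r" if "i \<le> 2 ^ n" for i :: nat using \<open>s \<in> E (2 ^ n)\<close> that U(3) by (auto simp: E_def)
    have s: "s \<in> B r" using pw[of 1] that by (simp add: E_def)
    have "real (2 ^ n) * norm (\<phi> s) \<le> 2 * r" by (rule norm_le_of_pow_bounded[OF pw s])
    then show ?thesis using B_D[OF s] by (simp add: B_def field_simps)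
  qed
  obtain \<delta> K where K: "\<delta> > 0" "K \<ge> 1" "\<And>x y. x \<in> B \<delta> \<Longrightarrow> y \<in> B \<delta> \<Longrightarrow>
      commut x y \<in> D \<and> norm (\<phi> (commut x y)) \<le> K * norm (\<phi> x) * norm (\<phi> y)"
    by (rule commut_bound) blast
  obtain \<rho> L where L: "\<rho> > 0" "L \<ge> 1" "\<And>x. x \<in> B \<rho> \<Longrightarrow> g x \<in> D \<and> norm (\<phi> (g x)) \<le> L * norm (\<phi> x)"
    by (rule endo_Lipschitz_at_one[OF g]) blast
  obtain k where k: "L < 2 ^ k"
    using real_arch_pow[of 2 L] by auto
  \<comment> \<open>\<open>K * \<epsilon> \<le> 1\<close> keeps every partial commutator of norm at
    most \<epsilon>, so \<open>commut_bound\<close> applies again at the next entry.\<close>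
  have comm_small: "c \<in> D \<and> norm (\<phi> c) \<le> K ^ m * \<epsilon> ^ Suc m"
    if "c \<in> iterated_commutators (B \<epsilon>) m" "0 \<le> \<epsilon>" "\<epsilon> \<le> \<delta>" "K * \<epsilon> \<le> 1" for c \<epsilon> m
    using that(1)
  proof (induction m arbitrary: c)
    case 0
    then show ?case by (simp add: B_def)
  next
    case (Suc m)
    then obtain a s where a: "a \<in> iterated_commutators (B \<epsilon>) m" "s \<in> B \<epsilon>" "c = commut a s" by auto
    have IH: "a \<in> D" "norm (\<phi> a) \<le> K ^ m * \<epsilon> ^ Suc m" using Suc.IH[OF a(1)] by auto
    have "K ^ m * \<epsilon> ^ Suc m = (K * \<epsilon>) ^ m * \<epsilon>" by (simp add: power_mult_distrib)
    also have "\<dots> \<le> 1 * \<epsilon>" using that K(2) by (intro mult_right_mono power_le_one) auto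
    finally have "a \<in> B \<delta>" using IH that by (auto simp: B_def)
    moreover have "s \<in> B \<delta>" using a(2) B_mono[OF that(3)] by blast
    ultimately have c: "c \<in> D" "norm (\<phi> c) \<le> K * norm (\<phi> a) * norm (\<phi> s)" using K(3) a(3) by auto
    note c(2)
    also have "K * norm (\<phi> a) * norm (\<phi> s) \<le> K * (K ^ m * \<epsilon> ^ Suc m) * \<epsilon>"
      using IH(2) B_norm[OF a(2)] K(2) that(2) by (intro mult_mono mult_left_mono) auto
    finally show ?case using c(1) by (simp add: algebra_simps)
  qed
  \<comment> \<open>Since \<open>L \<ge> 1\<close>, the hypothesis for \<open>n\<close> implies it
    for all smaller exponents, so the earlier iterates stay in \<open>B \<rho>\<close>.\<close>
  have orbit: "(g ^^ n) c \<in> D \<and> norm (\<phi> ((g ^^ n) c)) \<le> L ^ n * norm (\<phi> c)"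
    if c: "c \<in> D" "L ^ n * norm (\<phi> c) \<le> \<rho>" for c n
    using that
  proof (induction n)
    case (Suc n)
    have "L ^ n * norm (\<phi> c) \<le> L ^ Suc n * norm (\<phi> c)"
      using L(2) by (intro mult_right_mono power_increasing) auto
    then have IH: "(g ^^ n) c \<in> D" "norm (\<phi> ((g ^^ n) c)) \<le> L ^ n * norm (\<phi> c)" "L ^ n * norm (\<phi> c) \<le> \<rho>"
      using Suc by auto
    then have "(g ^^ n) c \<in> B \<rho>" by (simp add: B_def)
    from L(3)[OF this] have 1: "g ((g ^^ n) c) \<in> D" "norm (\<phi> (g ((g ^^ n) c))) \<le> L * norm (\<phi> ((g ^^ n) c))"
      by auto
    note 1(2)
    also have "L * norm (\<phi> ((g ^^ n) c)) \<le> L * (L ^ n * norm (\<phi> c))"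
      using IH(2) L(2) by (intro mult_left_mono) auto
    finally show ?case using 1 by simp
  qed simp
  \<comment> \<open>Chosen so that
    \<open>L ^ n * (K ^ k * (2 * r / 2 ^ n) ^ Suc k) = A * q ^ n\<close>.\<close>
  define A where "A = K ^ k * (2 * r) ^ Suc k"
  define q where "q = L / 2 ^ Suc k"
  have q: "0 \<le> q" "q < 1"
    using L(2) k by (auto simp: q_def)
  have "c = \<one>" if c: "c \<in> iterated_commutators (U 0) k" for c
  proof -
    define \<epsilon> where "\<epsilon> n = 2 * r / 2 ^ n" for n :: nat
    have \<epsilon>0: "\<epsilon> n \<ge> 0" for n using radius by (simp add: \<epsilon>_def)
    have main: "c \<in> D \<and> norm (\<phi> c) \<le> A * q ^ n"
      if n: "\<epsilon> n \<le> \<delta>" "K * \<epsilon> n \<le> 1" "A * q ^ n \<le> \<rho>" for n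
    proof -
      have "U 0 \<subseteq> (g ^^ n) ` B (\<epsilon> n)"
      proof
        fix s assume "s \<in> U 0"
        then obtain s' where "s' \<in> E (2 ^ n)" "(g ^^ n) s' = s" using pre by blast
        then show "s \<in> (g ^^ n) ` B (\<epsilon> n)" using E_small by (auto simp: \<epsilon>_def)
      qed
      then obtain c' where c': "c' \<in> iterated_commutators (B (\<epsilon> n)) k" "(g ^^ n) c' = c"
        using hom_iterated_commutators[OF g.pow_hom _ _ c, of "B (\<epsilon> n)" n] B_carrier by blast
      have 1: "c' \<in> D" "norm (\<phi> c') \<le> K ^ k * \<epsilon> n ^ Suc k"
        using comm_small[OF c'(1) \<epsilon>0 n(1,2)] by auto
      have "L ^ n * norm (\<phi> c') \<le> L ^ n * (K ^ k * \<epsilon> n ^ Suc k)"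
        using 1(2) L(2) by (intro mult_left_mono) auto
      also have "\<dots> = A * q ^ n"
        by (simp add: A_def q_def \<epsilon>_def power_divide power_mult_distrib power_mult[symmetric] mult.commute)
      finally have 2: "L ^ n * norm (\<phi> c') \<le> A * q ^ n" .
      then show ?thesis using orbit[OF 1(1), of n] n(3) c'(2) by auto
    qed
    \<comment> \<open>\<open>c\<close> does not depend on \<open>n\<close>, so a bound valid for all
      large \<open>n\<close> and tending to \<open>0\<close> forces
      \<open>\<phi> c = 0\<close>.\<close>
    have q0: "(\<lambda>n. A * q ^ n) \<longlonglongrightarrow> 0"
      using tendsto_mult[OF tendsto_const LIMSEQ_realpow_zero[OF q]] by simp
    have \<epsilon>lim: "\<epsilon> \<longlonglongrightarrow> 0"
      using tendsto_mult[OF tendsto_const[of "2 * r"] LIMSEQ_realpow_zero[of "1/2"]]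
      by (simp add: \<epsilon>_def[abs_def] power_divide)
    have "\<forall>\<^sub>F n in sequentially. \<epsilon> n < \<delta>" using order_tendstoD(2)[OF \<epsilon>lim K(1)] .
    moreover have "\<forall>\<^sub>F n in sequentially. \<epsilon> n < 1 / K" using order_tendstoD(2)[OF \<epsilon>lim, of "1 / K"] K(2) by simp
    moreover have "\<forall>\<^sub>F n in sequentially. A * q ^ n < \<rho>" using order_tendstoD(2)[OF q0 L(1)] .
    ultimately have ev: "\<forall>\<^sub>F n in sequentially. c \<in> D \<and> norm (\<phi> c) \<le> A * q ^ n"
    proof eventually_elim
      case (elim n)
      then show ?case using K(2) by (intro main) (auto simp: field_simps)
    qed
    have "norm (\<phi> c) \<le> 0"
      by (rule tendsto_lowerbound[OF q0]) (use ev in \<open>auto elim: eventually_mono\<close>)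
    moreover have "c \<in> D" using eventually_happens[OF ev] by auto
    ultimately show ?thesis using coord_inj by simp
  qed
  then show ?thesis using U(1) by (intro exI[of _ "U 0"] exI[of _ k]) blast
qed

end

section \<open>Charts of a Lie group\<close>

locale identity_chart = lie_group G T A for G (structure) and T
    and A :: "('a, 'e::{real_normed_vector, heine_borel}) chart set" +
  fixes U :: "'a set" and \<phi> :: "'a \<Rightarrow> 'e"
  assumes chart: "(U, \<phi>) \<in> A" and one_in_chart: "\<one> \<in> U"
begin

lemma finite_dim: "\<exists>B::'e set. finite B \<and> span B = UNIV"
  using atlas by (auto simp: smooth_atlas_def)

lemma chart_open: "openin T U" "open (\<phi> ` U)"
  and chart_homeo: "homeomorphic_map (subtopology T U) (top_of_set (\<phi> ` U)) \<phi>"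
  using atlas chart by (auto simp: smooth_atlas_def)

lemma chart_carrier: "U \<subseteq> carrier G"
  using openin_subset[OF chart_open(1)] by (simp add: topspace_eq)

lemma chart_inj: "inj_on \<phi> U"
  using homeomorphic_imp_injective_map[OF chart_homeo] chart_carrier
  by (simp add: topspace_eq Int_absorb1)

lemma inv_chart [simp]: "x \<in> U \<Longrightarrow> inv_into U \<phi> (\<phi> x) = x"
  using chart_inj by simp

lemma open_chart_image:
  assumes "openin T V" "V \<subseteq> U"
  shows "open (\<phi> ` V)"
proof -
  have "openin (subtopology T U) V" using assms by (simp add: openin_open_subtopology chart_open)
  then have "openin (top_of_set (\<phi> ` U)) (\<phi> ` V)"
    using homeomorphic_map_openness_eq[OF chart_homeo] by blast
  then show ?thesis using chart_open(2) openin_open_trans by blast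
qed

lemma continuous_chart: "continuous_map (subtopology T U) euclidean \<phi>"
  using homeomorphic_imp_continuous_map[OF chart_homeo] by (simp add: continuous_map_in_subtopology)

lemma openin_chart_preimage:
  assumes "open S"
  shows "openin T {x \<in> U. \<phi> x \<in> S}"
proof -
  have "openin (subtopology T U) {x \<in> topspace (subtopology T U). \<phi> x \<in> S}"
    by (rule openin_continuous_map_preimage[OF continuous_chart]) (use assms in simp)
  also have "{x \<in> topspace (subtopology T U). \<phi> x \<in> S} = {x \<in> U. \<phi> x \<in> S}"
    using chart_carrier by (auto simp: topspace_eq)
  finally show ?thesis using chart_open(1) openin_trans_full by blast
qed

lemma continuous_inv_chart: "continuous_map (top_of_set (\<phi> ` U)) T (inv_into U \<phi>)"
proof -
  obtain \<psi> where "homeomorphic_maps (subtopology T U) (top_of_set (\<phi> ` U)) \<phi> \<psi>"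
    using chart_homeo homeomorphic_map_maps by blast
  then have c: "continuous_map (top_of_set (\<phi> ` U)) (subtopology T U) \<psi>"
    and \<psi>: "\<And>x. x \<in> U \<Longrightarrow> \<psi> (\<phi> x) = x"
    using chart_carrier by (auto simp: homeomorphic_maps_def topspace_eq Int_absorb1)
  have "continuous_map (top_of_set (\<phi> ` U)) T \<psi>"
    using c by (simp add: continuous_map_in_subtopology)
  then show ?thesis by (rule continuous_map_eq) (use \<psi> in auto)
qed

section \<open>Compactness and openness in a chart at the identity\<close>

lemma nbhd_chart_ball:
  assumes "\<rho> > 0"
  shows "nbhd {x \<in> U. norm (\<phi> x - \<phi> \<one>) \<le> \<rho>}"
proof (rule nbhd_mono)
  show "nbhd {x \<in> U. \<phi> x \<in> ball (\<phi> \<one>) \<rho>}"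
    using assms one_in_chart by (intro nbhd_openin openin_chart_preimage) auto
qed (use chart_carrier in \<open>auto simp: dist_norm norm_minus_commute\<close>)

lemma chart_ball_small:
  assumes "nbhd W"
  obtains \<rho> where "\<rho> > 0" "{x \<in> U. norm (\<phi> x - \<phi> \<one>) \<le> \<rho>} \<subseteq> W" "cball (\<phi> \<one>) \<rho> \<subseteq> \<phi> ` U"
proof -
  obtain V where V: "openin T V" "\<one> \<in> V" "V \<subseteq> W"
    using assms by (auto simp: neighbourhood_of_def)
  have "open (\<phi> ` (V \<inter> U))" using V chart_open by (intro open_chart_image) auto
  moreover have "\<phi> \<one> \<in> \<phi> ` (V \<inter> U)" using V one_in_chart by blast
  ultimately obtain \<rho> where \<rho>: "\<rho> > 0" "cball (\<phi> \<one>) \<rho> \<subseteq> \<phi> ` (V \<inter> U)"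
    by (meson open_contains_cball)
  have "x \<in> W" if "x \<in> U" "norm (\<phi> x - \<phi> \<one>) \<le> \<rho>" for x
  proof -
    have "\<phi> x \<in> \<phi> ` (V \<inter> U)" using \<rho>(2) that by (auto simp: dist_norm norm_minus_commute)
    then have "x \<in> V" using chart_inj that(1) by (auto simp: inj_on_def)
    then show ?thesis using V by blast
  qed
  then show ?thesis using that[OF \<rho>(1)] \<rho>(2) by blast
qed

text \<open>Closed coordinate balls are compact by the Heine-Borel property, and the inverse chart
  carries them to \<open>G\<close>.\<close>

lemma nbhd_compact:
  assumes "nbhd W"
  shows "\<exists>K. nbhd K \<and> compactin T K \<and> K \<subseteq> W"
proof -
  obtain \<rho> where \<rho>: "\<rho> > 0" "{x \<in> U. norm (\<phi> x - \<phi> \<one>) \<le> \<rho>} \<subseteq> W" "cball (\<phi> \<one>) \<rho> \<subseteq> \<phi> ` U"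
    using chart_ball_small[OF assms] .
  have "compactin (top_of_set (\<phi> ` U)) (cball (\<phi> \<one>) \<rho>)"
    using \<rho>(3) by (simp add: compactin_subtopology compactin_euclidean_iff)
  then have "compactin T (inv_into U \<phi> ` cball (\<phi> \<one>) \<rho>)"
    using image_compactin continuous_inv_chart by blast
  also have "inv_into U \<phi> ` cball (\<phi> \<one>) \<rho> = {x \<in> U. norm (\<phi> x - \<phi> \<one>) \<le> \<rho>}" (is "?L = ?R")
  proof
    show "?L \<subseteq> ?R"
    proof
      fix x assume "x \<in> ?L"
      then obtain p where p: "p \<in> cball (\<phi> \<one>) \<rho>" "x = inv_into U \<phi> p" by blast
      then obtain y where "y \<in> U" "p = \<phi> y" using \<rho>(3) by blast
      then show "x \<in> ?R" using p by (simp add: dist_norm norm_minus_commute)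
    qed
    show "?R \<subseteq> ?L"
    proof
      fix x assume "x \<in> ?R"
      then have "x = inv_into U \<phi> (\<phi> x)" "\<phi> x \<in> cball (\<phi> \<one>) \<rho>"
        by (simp_all add: dist_norm norm_minus_commute)
      then show "x \<in> ?L" by blast
    qed
  qed
  finally show ?thesis using nbhd_chart_ball[OF \<rho>(1)] \<rho>(2) by blast
qed

text \<open>Near \<open>\<one>\<close> the coordinate expression of \<alpha> is continuous and
  injective, so it is open by invariance of domain; the chart transports this back.\<close>

lemma nbhd_image_of_expansive:
  assumes endo: "continuous_endomorphism G T \<alpha>" and exp: "positively_expansive G T \<alpha>" and W: "nbhd W"
  shows "nbhd (\<alpha> ` W)"
proof -
  interpret topological_group_endo G T \<alpha>
    using endo by unfold_locales (auto simp: continuous_endomorphism_def)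
  obtain V where V: "nbhd V" "inj_on \<alpha> V" using locally_injective_of_expansive[OF exp] .
  have U: "nbhd U" using chart_open(1) one_in_chart by (rule nbhd_openin)
  have "nbhd (W \<inter> V \<inter> U \<inter> {x \<in> carrier G. \<alpha> x \<in> U})"
    using W V U by (intro nbhd_Int nbhd_preimage continuous_endo) auto
  then obtain W0 where W0: "openin T W0" "\<one> \<in> W0" "W0 \<subseteq> W \<inter> V \<inter> U \<inter> {x \<in> carrier G. \<alpha> x \<in> U}"
    by (auto simp: neighbourhood_of_def)
  define f where "f = \<phi> \<circ> \<alpha> \<circ> inv_into U \<phi>"
  have S: "open (\<phi> ` W0)" using W0 by (intro open_chart_image) auto
  have f\<phi>: "f (\<phi> x) = \<phi> (\<alpha> x)" if "x \<in> W0" for x using that W0 by (auto simp: f_def)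
  have im: "f ` \<phi> ` W0 = \<phi> ` \<alpha> ` W0" using f\<phi> by (auto simp: image_comp)
  have "continuous_map (top_of_set (\<phi> ` W0)) T (\<alpha> \<circ> inv_into U \<phi>)"
  proof (rule continuous_map_compose[OF _ continuous_endo])
    have "\<phi> ` W0 \<subseteq> \<phi> ` U" using W0(3) by blast
    then show "continuous_map (top_of_set (\<phi> ` W0)) T (inv_into U \<phi>)"
      using continuous_inv_chart continuous_map_from_subtopology_mono by blast
  qed
  moreover have "(\<alpha> \<circ> inv_into U \<phi>) ` \<phi> ` W0 \<subseteq> U"
  proof (intro subsetI)
    fix y assume "y \<in> (\<alpha> \<circ> inv_into U \<phi>) ` \<phi> ` W0"
    then obtain x where x: "x \<in> W0" "y = \<alpha> (inv_into U \<phi> (\<phi> x))" by auto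
    then have "x \<in> U" "\<alpha> x \<in> U" using W0(3) by auto
    then show "y \<in> U" using x by simp
  qed
  ultimately have "continuous_map (top_of_set (\<phi> ` W0)) (subtopology T U) (\<alpha> \<circ> inv_into U \<phi>)"
    by (auto simp: continuous_map_in_subtopology)
  from continuous_map_compose[OF this continuous_chart] have "continuous_on (\<phi> ` W0) f"
    by (simp add: f_def o_assoc)
  moreover have "inj_on f (\<phi> ` W0)"
  proof (rule inj_onI)
    fix p q assume "p \<in> \<phi> ` W0" "q \<in> \<phi> ` W0" "f p = f q"
    then obtain x y where xy: "x \<in> W0" "y \<in> W0" "p = \<phi> x" "q = \<phi> y" "\<phi> (\<alpha> x) = \<phi> (\<alpha> y)"
      using f\<phi> by auto
    then have "\<alpha> x = \<alpha> y" using W0(3) inj_onD[OF chart_inj] by blast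
    then have "x = y" using xy W0(3) inj_onD[OF V(2)] by blast
    then show "p = q" using xy by simp
  qed
  ultimately have "open (f ` \<phi> ` W0)"
    using invariance_of_domain_finite_dim S finite_dim by metis
  then have op: "openin T {x \<in> U. \<phi> x \<in> \<phi> ` \<alpha> ` W0}" unfolding im by (rule openin_chart_preimage)
  have "{x \<in> U. \<phi> x \<in> \<phi> ` \<alpha> ` W0} = \<alpha> ` W0"
  proof (intro equalityI subsetI)
    fix x assume "x \<in> {x \<in> U. \<phi> x \<in> \<phi> ` \<alpha> ` W0}"
    then obtain w where "x \<in> U" "w \<in> W0" "\<phi> x = \<phi> (\<alpha> w)" by auto
    then have "x = \<alpha> w" using W0(3) inj_onD[OF chart_inj] by blast
    then show "x \<in> \<alpha> ` W0" using \<open>w \<in> W0\<close> by blast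
  qed (use W0(3) in auto)
  then have "openin T (\<alpha> ` W0)" using op by simp
  then have "nbhd (\<alpha> ` W0)" using W0(2) by (intro nbhd_openin) (auto intro!: image_eqI[of _ _ \<one>])
  then show ?thesis by (rule nbhd_mono) (use W0(3) nbhd_subset[OF W] in auto)
qed

text \<open>For the product \<open>m\<close> in coordinates and \<open>a = \<phi> \<one>\<close>,
  the unit laws give \<open>m (p, a) = p\<close>, \<open>m (a, q) = q\<close> and
  \<open>m (a, a) = a\<close>. The mixed second difference at \<open>a\<close> is thus the deviation
  of the product from addition.\<close>

lemma chart_local_coordinates:
  obtains r C where "local_coordinates G T (\<lambda>x. \<phi> x - \<phi> \<one>) U r C"
proof -
  define a where "a = \<phi> \<one>"
  define m where "m = (\<lambda>(p, q). \<phi> (inv_into U \<phi> p \<otimes> inv_into U \<phi> q))"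
  define \<Omega> where "\<Omega> = {(p, q). p \<in> \<phi> ` U \<and> q \<in> \<phi> ` U \<and> inv_into U \<phi> p \<otimes> inv_into U \<phi> q \<in> U}"
  have smooth: "Cn_on n m \<Omega>" for n
    using smooth_mult[OF chart chart chart] unfolding m_def \<Omega>_def smooth_on_def by blast
  have m: "m (\<phi> x, \<phi> y) = \<phi> (x \<otimes> y)" if "x \<in> U" "y \<in> U" for x y using that by (simp add: m_def)
  have U: "nbhd U" using chart_open(1) one_in_chart by (rule nbhd_openin)
  obtain V where V: "nbhd V" "\<And>x y. x \<in> V \<Longrightarrow> y \<in> V \<Longrightarrow> x \<otimes> y \<in> U"
    by (rule nbhd_mult[OF U]) blast
  obtain \<rho> where \<rho>: "\<rho> > 0" "{x \<in> U. norm (\<phi> x - a) \<le> \<rho>} \<subseteq> V" "cball a \<rho> \<subseteq> \<phi> ` U"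
    using chart_ball_small[OF V(1)] unfolding a_def .
  have \<Omega>: "cball a \<rho> \<times> cball a \<rho> \<subseteq> \<Omega>"
  proof
    fix z assume "z \<in> cball a \<rho> \<times> cball a \<rho>"
    then obtain p q where z: "z = (p, q)" and pq: "p \<in> cball a \<rho>" "q \<in> cball a \<rho>" by (rule SigmaE)
    obtain x where x: "x \<in> U" "p = \<phi> x" using subsetD[OF \<rho>(3) pq(1)] by (rule imageE)
    obtain y where y: "y \<in> U" "q = \<phi> y" using subsetD[OF \<rho>(3) pq(2)] by (rule imageE)
    note xy = z[unfolded x(2) y(2)] x(1) y(1) pq[unfolded x(2) y(2)]
    then have "x \<in> V" "y \<in> V" using \<rho>(2) by (auto simp: dist_norm norm_minus_commute)
    then show "z \<in> \<Omega>" using xy V(2) by (simp add: \<Omega>_def)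
  qed
  obtain B :: "'e set" where B: "finite B" "span B = UNIV" using finite_dim by blast
  obtain C1 where C1: "C1 \<ge> 0" "\<And>p q. p \<in> cball a \<rho> \<Longrightarrow> q \<in> cball a \<rho> \<Longrightarrow>
      norm (m (p, q) - m (p, a) - m (a, q) + m (a, a)) \<le> C1 * norm (p - a) * norm (q - a)"
    by (rule C2_mixed_difference_bound[OF B smooth \<Omega>]) blast
  obtain L where L: "L \<ge> 0" "\<And>x y. x \<in> cball a \<rho> \<times> cball a \<rho> \<Longrightarrow> y \<in> cball a \<rho> \<times> cball a \<rho> \<Longrightarrow>
      norm (m x - m y) \<le> L * norm (x - y)"
    by (rule C1_Lipschitz_on_compact_convex[OF _ span_Times_UNIV[OF B(2) B(2)] smooth _ _ \<Omega>])
      (use B(1) in \<open>auto intro!: compact_Times convex_Times\<close>)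
  define C where "C = max C1 L"
  \<comment> \<open>The second bound on \<open>r\<close> enforces \<open>C * r \<le> 1 / 2\<close>;
    adding \<open>1\<close> avoids division by zero.\<close>
  define r where "r = min \<rho> (1 / (2 * (C + 1)))"
  have C0: "C \<ge> 0" "C1 \<le> C" "L \<le> C" using C1(1) by (auto simp: C_def)
  have r: "r > 0" "r \<le> \<rho>" "C * r \<le> 1 / 2"
  proof -
    show "r > 0" "r \<le> \<rho>" using \<rho>(1) C0 by (auto simp: r_def)
    have "C * r \<le> C * (1 / (2 * (C + 1)))" using C0 by (intro mult_left_mono) (auto simp: r_def)
    also have "\<dots> \<le> 1 / 2" using C0 by (simp add: field_simps)
    finally show "C * r \<le> 1 / 2" .
  qed
  have ball: "\<phi> x \<in> cball a \<rho>" "x \<in> V" if "x \<in> U" "norm (\<phi> x - a) \<le> r" for x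
    using that r(2) \<rho>(2) by (auto simp: dist_norm norm_minus_commute)
  have a: "a \<in> cball a \<rho>" using \<rho>(1) by simp
  have "local_coordinates G T (\<lambda>x. \<phi> x - a) U r C"
  proof unfold_locales
    show "U \<subseteq> carrier G" by (rule chart_carrier)
    show "\<one> \<in> U" "\<phi> \<one> - a = 0" using one_in_chart by (auto simp: a_def)
    show "x = \<one>" if "x \<in> U" "\<phi> x - a = 0" for x
      using that one_in_chart inj_onD[OF chart_inj] by (simp add: a_def)
    show "nbhd {x \<in> U. norm (\<phi> x - a) \<le> \<sigma>}" if "\<sigma> > 0" for \<sigma>
      unfolding a_def by (rule nbhd_chart_ball[OF that])
    show "\<exists>\<sigma>>0. {x \<in> U. norm (\<phi> x - a) \<le> \<sigma>} \<subseteq> W" if "nbhd W" for W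
      using chart_ball_small[OF that] unfolding a_def by metis
    show "r > 0" "C \<ge> 0" "C * r \<le> 1 / 2" using r C0 by auto
    fix x y assume x: "x \<in> U" "norm (\<phi> x - a) \<le> r" and y: "y \<in> U" "norm (\<phi> y - a) \<le> r"
    have car: "x \<in> carrier G" "y \<in> carrier G" using x y chart_carrier by auto
    show "x \<otimes> y \<in> U" using ball x y V(2) by blast
    have "norm (\<phi> (x \<otimes> y) - \<phi> x - \<phi> y + a) \<le> C1 * norm (\<phi> x - a) * norm (\<phi> y - a)"
      using C1(2)[OF ball(1)[OF x] ball(1)[OF y]] m[OF x(1) y(1)] m[OF x(1) one_in_chart]
        m[OF one_in_chart y(1)] m[OF one_in_chart one_in_chart] car
      by (simp add: a_def)
    also have "\<dots> \<le> C * norm (\<phi> x - a) * norm (\<phi> y - a)"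
      using C0 by (intro mult_right_mono) auto
    finally show "norm (\<phi> (x \<otimes> y) - a - (\<phi> x - a) - (\<phi> y - a)) \<le> C * norm (\<phi> x - a) * norm (\<phi> y - a)"
      by (simp add: algebra_simps)
    fix z assume z: "z \<in> U" "norm (\<phi> z - a) \<le> r"
    have "norm (\<phi> (x \<otimes> z) - \<phi> (y \<otimes> z)) \<le> L * norm ((\<phi> x, \<phi> z) - (\<phi> y, \<phi> z))"
      using L(2)[of "(\<phi> x, \<phi> z)" "(\<phi> y, \<phi> z)"] ball(1)[OF x] ball(1)[OF y] ball(1)[OF z]
        m[OF x(1) z(1)] m[OF y(1) z(1)] by simp
    also have "\<dots> = L * norm (\<phi> x - \<phi> y)" by (simp add: norm_Pair)
    also have "\<dots> \<le> C * norm (\<phi> x - \<phi> y)" using C0 by (intro mult_right_mono) auto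
    finally show "norm (\<phi> (x \<otimes> z) - a - (\<phi> (y \<otimes> z) - a)) \<le> C * norm (\<phi> x - a - (\<phi> y - a))"
      by simp
  qed
  then show ?thesis using that unfolding a_def by blast
qed

end

theorem theorem2:
  fixes G :: "('a, 'm) monoid_scheme"
    and T :: "'a topology"
    and A :: "('a, 'e::{real_normed_vector, heine_borel}) chart set"
  assumes "lie_group G T A"
  shows "(\<forall>\<alpha>. continuous_endomorphism G T \<alpha> \<longrightarrow>
            (positively_expansive G T \<alpha> \<longrightarrow> has_shadowing G T \<alpha>) \<and>
            (topologically_expanding G T \<alpha> \<longleftrightarrow> positively_expansive G T \<alpha>)) \<and>
         ((\<exists>\<alpha>. continuous_endomorphism G T \<alpha> \<and> positively_expansive G T \<alpha>) \<longrightarrow>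
            nilpotent_group (G\<lparr>carrier := identity_component G T\<rparr>))"
proof -
  interpret lie_group G T A by (rule assms)
  have "\<one>\<^bsub>G\<^esub> \<in> (\<Union>(U, \<phi>)\<in>A. U)" using atlas topspace_eq by (simp add: smooth_atlas_def)
  then obtain U \<phi> where "(U, \<phi>) \<in> A" "\<one>\<^bsub>G\<^esub> \<in> U" by auto
  then interpret identity_chart G T A U \<phi> by unfold_locales
  have shadowing: "has_shadowing G T \<alpha>"
    if "continuous_endomorphism G T \<alpha>" "positively_expansive G T \<alpha>" for \<alpha>
  proof -
    interpret topological_group_endo G T \<alpha>
      using that(1) by unfold_locales (auto simp: continuous_endomorphism_def)
    show ?thesis
      by (rule shadowing_of_expansive[OF that(2) nbhd_compact nbhd_image_of_expansive[OF that]])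
  qed
  have "nilpotent_group (G\<lparr>carrier := identity_component G T\<rparr>)"
    if "continuous_endomorphism G T \<alpha>" "positively_expansive G T \<alpha>" for \<alpha>
  proof -
    obtain r C where "local_coordinates G T (\<lambda>x. \<phi> x - \<phi> \<one>\<^bsub>G\<^esub>) U r C"
      by (rule chart_local_coordinates)
    then interpret local_coordinates G T "\<lambda>x. \<phi> x - \<phi> \<one>\<^bsub>G\<^esub>" U r C .
    have "\<exists>S k. nbhd S \<and> iterated_commutators S k \<subseteq> {\<one>\<^bsub>G\<^esub>}"
      using that(1)
      by (intro commutators_trivial_of_expansive[OF _ _ that(2) nbhd_compact nbhd_image_of_expansive[OF that]])
        (auto simp: continuous_endomorphism_def)
    then obtain S k where S: "nbhd S" "iterated_commutators S k \<subseteq> {\<one>\<^bsub>G\<^esub>}" by blast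
    show ?thesis
      by (rule nilpotent_subgroup_of_generate[OF nbhd_subset[OF S(1)] S(2) identity_component_subgroup
            identity_component_subset_generate[OF S(1)]])
  qed
  then show ?thesis using shadowing by (auto simp: topologically_expanding_def)
qed

end
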